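(* (a) In the language $\mathcal L_\Box^{\langle t\rangle}$: $\mathrm{K4}t$ has the finite model property over transitive frames, $\mathrm{KD4}t$ over serial transitive frames, and $\mathrm{S4}t$ over reflexive transitive frames. (b) In the language $\mathcal L_{\Box\forall}^{\langle t\rangle}$: $\mathrm{K4}t\mathrm{.U}$ has the finite model property over transitive frames, $\mathrm{KD4}t\mathrm{.U}$ over serial transitive frames, and $\mathrm{S4}t\mathrm{.U}$ over reflexive transitive frames. (c) In the language $\mathcal L_{\Box\forall}^{\langle t\rangle}$: $\mathrm{K4}t\mathrm{.UC}$ has the finite model property over path-connected transitive frames, $\mathrm{KD4}t\mathrm{.UC}$ over path-connected serial transitive frames, and $\mathrm{S4}t\mathrm{.UC}$ over path-connected reflexive transitive frames.
   Context: $\mathsf{Var}$ is a set of propositional variables. $\mathcal L_{\Box\forall}^{\langle t\rangle}$-formulas: atoms; $\top$; $\neg\varphi$; $\varphi\wedge\psi$; $\Box\varphi$; $\forall\varphi$; $\langle t\rangle\Gamma$ for each non-empty finite set $\Gamma$ of formulas. $\mathcal L_\Box^{\langle t\rangle}$ consists of the formulas not involving $\forall$. Abbreviations: $\vee,\to$ as usual, $\Diamond=\neg\Box\neg$, $\exists=\neg\forall\neg$, $\Box^*\varphi=\varphi\wedge\Box\varphi$. Kripke semantics in $(W,R,h)$, $h:\mathsf{Var}\to\wp(W)$: atoms, $\top$, Booleans as usual; $\Box\varphi$ is true at $w$ iff $\varphi$ is true at all $v$ with $wRv$; $\forall\varphi$ is true at $w$ iff $\varphi$ is true at all $v\in W$;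 $\langle t\rangle\Gamma$ is true at $w$ iff there is an infinite sequence $w=w_0,w_1,\dots$ with $w_nRw_{n+1}$ for all $n$ such that each $\gamma\in\Gamma$ is true at $w_n$ for infinitely many $n$. A frame $(W,R)$ ($W\ne\emptyset$) is serial if every $w$ has some $v$ with $wRv$. It is path-connected if any two points are joined by a finite sequence $w_0,\dots,w_n$ ($n\ge0$) with $w_iRw_{i+1}$ or $w_{i+1}Rw_i$ for each $i<n$. $\mathrm{K4}t$: axioms are all instances of propositional tautologies; $\Box(\varphi\to\psi)\to(\Box\varphi\to\Box\psi)$; $\Diamond\Diamond\varphi\to\Diamond\varphi$; (Fix) $\langle t\rangle\Gamma\to\Diamond(\gamma\wedge\langle t\rangle\Gamma)$ for $\gamma\in\Gamma$; (Ind) $\Box^*(\varphi\to\bigwedge_{\gamma\in\Gamma}\Diamond(\gamma\wedge\varphi))\to(\varphi\to\langle t\rangle\Gamma)$; rules modus ponens and from $\varphi$ infer $\Box\varphi$. $\mathrm{KD4}t$ adds the axiom $\Diamond\top$; $\mathrm{S4}t$ adds the scheme $\varphi\to\Diamond\varphi$ to $\mathrm{K4}t$. Suffix $\mathrm{.U}$: the schemes and rules are taken in the language with $\forall$ and one adds the S5 axioms for $\forall$ ($\forall(\varphi\to\psi)\to(\forall\varphi\to\forall\psi)$, $\forall\varphi\to\varphi$, $\forall\varphi\to\forall\forall\varphi$, $\varphi\to\forall\exists\varphi$), the rule from $\varphi$ infer $\forall\varphi$, and the scheme $\forall\varphi\to\Box\varphi$. Suffix $\mathrm{.UC}$: additionally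 the scheme $\forall(\Box^*\varphi\vee\Box^*\neg\varphi)\to(\forall\varphi\vee\forall\neg\varphi)$. A formula is consistent with a system $H$ if its negation is not a theorem of $H$. $H$ has the finite model property over a class $\mathcal K$ of frames if each $H$-consistent formula is true at some world of some model on a finite frame in $\mathcal K$. *)

theory Defs
  imports Main "HOL-Library.FSet"
begin

section \<open>Syntax\<close>

text \<open>The set of propositional variables is the type \<open>'v\<close>. The datatype also contains \<open>\<langle>t\<rangle>\<close> applied to
  the empty set; the languages below exclude it.\<close>

datatype 'v fm =
    Atom 'v
  | Top
  | Neg "'v fm"
  | And "'v fm" "'v fm" (infixr "\<^bold>\<and>" 65)
  | Box "'v fm"
  | All "'v fm"
  | Tangle "'v fm fset"

abbreviation Or :: "'v fm \<Rightarrow> 'v fm \<Rightarrow> 'v fm" (infixr "\<^bold>\<or>" 60)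
  where "\<phi> \<^bold>\<or> \<psi> \<equiv> Neg (Neg \<phi> \<^bold>\<and> Neg \<psi>)"

abbreviation Imp :: "'v fm \<Rightarrow> 'v fm \<Rightarrow> 'v fm" (infixr "\<^bold>\<longrightarrow>" 55)
  where "\<phi> \<^bold>\<longrightarrow> \<psi> \<equiv> Neg (\<phi> \<^bold>\<and> Neg \<psi>)"

abbreviation Dia :: "'v fm \<Rightarrow> 'v fm"
  where "Dia \<phi> \<equiv> Neg (Box (Neg \<phi>))"

abbreviation Ex_fm :: "'v fm \<Rightarrow> 'v fm"
  where "Ex_fm \<phi> \<equiv> Neg (All (Neg \<phi>))"

abbreviation BoxStar :: "'v fm \<Rightarrow> 'v fm"
  where "BoxStar \<phi> \<equiv> \<phi> \<^bold>\<and> Box \<phi>"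

fun BigAnd :: "'v fm list \<Rightarrow> 'v fm" where
  "BigAnd [] = Top"
| "BigAnd [\<phi>] = \<phi>"
| "BigAnd (\<phi> # \<psi> # \<psi>s) = \<phi> \<^bold>\<and> BigAnd (\<psi> # \<psi>s)"

lemma size_Tangle_member [termination_simp]:
  assumes "\<gamma> |\<in>| \<Gamma>"
  shows "size \<gamma> < Suc (\<Sum>\<delta>\<in>fset \<Gamma>. Suc (size \<delta>))"
proof -
  have "Suc (size \<gamma>) \<le> (\<Sum>\<delta>\<in>fset \<Gamma>. Suc (size \<delta>))"
    using assms by (intro member_le_sum) auto
  then show ?thesis by simp
qed

inductive_set L_BoxAll :: "'v fm set" where
  "Atom p \<in> L_BoxAll"
| "Top \<in> L_BoxAll"
| "\<phi> \<in> L_BoxAll \<Longrightarrow> Neg \<phi> \<in> L_BoxAll"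
| "\<phi> \<in> L_BoxAll \<Longrightarrow> \<psi> \<in> L_BoxAll \<Longrightarrow> \<phi> \<^bold>\<and> \<psi> \<in> L_BoxAll"
| "\<phi> \<in> L_BoxAll \<Longrightarrow> Box \<phi> \<in> L_BoxAll"
| "\<phi> \<in> L_BoxAll \<Longrightarrow> All \<phi> \<in> L_BoxAll"
| "\<Gamma> \<noteq> {||} \<Longrightarrow> (\<And>\<gamma>. \<gamma> |\<in>| \<Gamma> \<Longrightarrow> \<gamma> \<in> L_BoxAll) \<Longrightarrow> Tangle \<Gamma> \<in> L_BoxAll"

fun forall_free :: "'v fm \<Rightarrow> bool" where
  "forall_free (Atom p) = True"
| "forall_free Top = True"
| "forall_free (Neg \<phi>) = forall_free \<phi>"
| "forall_free (\<phi> \<^bold>\<and> \<psi>) = (forall_free \<phi> \<and> forall_free \<psi>)"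
| "forall_free (Box \<phi>) = forall_free \<phi>"
| "forall_free (All \<phi>) = False"
| "forall_free (Tangle \<Gamma>) = (\<forall>\<gamma> \<in> fset \<Gamma>. forall_free \<gamma>)"

definition L_Box :: "'v fm set"
  where "L_Box = {\<phi> \<in> L_BoxAll. forall_free \<phi>}"

section \<open>Kripke semantics\<close>

definition frame :: "'w set \<Rightarrow> 'w rel \<Rightarrow> bool"
  where "frame W R \<longleftrightarrow> W \<noteq> {} \<and> R \<subseteq> W \<times> W"

definition serial_on :: "'w set \<Rightarrow> 'w rel \<Rightarrow> bool"
  where "serial_on W R \<longleftrightarrow> (\<forall>w\<in>W. \<exists>v\<in>W. (w, v) \<in> R)"

definition path_connected_on :: "'w set \<Rightarrow> 'w rel \<Rightarrow> bool"
  where "path_connected_on W R \<longleftrightarrow>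
    (\<forall>x\<in>W. \<forall>y\<in>W. \<exists>(n::nat) w. w 0 = x \<and> w n = y \<and> (\<forall>i\<le>n. w i \<in> W) \<and>
       (\<forall>i<n. (w i, w (Suc i)) \<in> R \<or> (w (Suc i), w i) \<in> R))"

fun sat :: "'w set \<Rightarrow> 'w rel \<Rightarrow> ('v \<Rightarrow> 'w set) \<Rightarrow> 'w \<Rightarrow> 'v fm \<Rightarrow> bool" where
  "sat W R h w (Atom p) = (w \<in> h p)"
| "sat W R h w Top = True"
| "sat W R h w (Neg \<phi>) = (\<not> sat W R h w \<phi>)"
| "sat W R h w (\<phi> \<^bold>\<and> \<psi>) = (sat W R h w \<phi> \<and> sat W R h w \<psi>)"
| "sat W R h w (Box \<phi>) = (\<forall>v. (w, v) \<in> R \<longrightarrow> sat W R h v \<phi>)"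
| "sat W R h w (All \<phi>) = (\<forall>v\<in>W. sat W R h v \<phi>)"
| "sat W R h w (Tangle \<Gamma>) =
    (\<exists>s::nat \<Rightarrow> 'w. s 0 = w \<and> (\<forall>n. (s n, s (Suc n)) \<in> R) \<and>
       (\<forall>\<gamma> \<in> fset \<Gamma>. infinite {n. sat W R h (s n) \<gamma>}))"

section \<open>Proof systems\<close>

text \<open>Propositional tautologies are formulas over an infinite set of variables of their own, so that
  the tautology instances do not depend on the size of \<open>'v\<close>.\<close>

datatype pfm = PVar nat | PTop | PNeg pfm | PAnd pfm pfm

primrec peval :: "(nat \<Rightarrow> bool) \<Rightarrow> pfm \<Rightarrow> bool" where
  "peval e (PVar i) = e i"
| "peval e PTop = True"
| "peval e (PNeg \<theta>) = (\<not> peval e \<theta>)"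
| "peval e (PAnd \<theta> \<eta>) = (peval e \<theta> \<and> peval e \<eta>)"

primrec psubst :: "(nat \<Rightarrow> 'v fm) \<Rightarrow> pfm \<Rightarrow> 'v fm" where
  "psubst \<sigma> (PVar i) = \<sigma> i"
| "psubst \<sigma> PTop = Top"
| "psubst \<sigma> (PNeg \<theta>) = Neg (psubst \<sigma> \<theta>)"
| "psubst \<sigma> (PAnd \<theta> \<eta>) = psubst \<sigma> \<theta> \<^bold>\<and> psubst \<sigma> \<eta>"

text \<open>In \<open>Ind\<close>, every enumeration of \<open>\<Gamma>\<close> is allowed for the conjunction over \<open>\<Gamma>\<close>.\<close>

inductive_set K4t_axioms :: "'v fm set" where
  Taut: "(\<And>e. peval e \<theta>) \<Longrightarrow> psubst \<sigma> \<theta> \<in> K4t_axioms"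
| K: "Box (\<phi> \<^bold>\<longrightarrow> \<psi>) \<^bold>\<longrightarrow> (Box \<phi> \<^bold>\<longrightarrow> Box \<psi>) \<in> K4t_axioms"
| Four: "Dia (Dia \<phi>) \<^bold>\<longrightarrow> Dia \<phi> \<in> K4t_axioms"
| Fix: "\<gamma> |\<in>| \<Gamma> \<Longrightarrow> Tangle \<Gamma> \<^bold>\<longrightarrow> Dia (\<gamma> \<^bold>\<and> Tangle \<Gamma>) \<in> K4t_axioms"
| Ind: "set \<gamma>s = fset \<Gamma> \<Longrightarrow> distinct \<gamma>s \<Longrightarrow>
    BoxStar (\<phi> \<^bold>\<longrightarrow> BigAnd (map (\<lambda>\<gamma>. Dia (\<gamma> \<^bold>\<and> \<phi>)) \<gamma>s)) \<^bold>\<longrightarrow> (\<phi> \<^bold>\<longrightarrow> Tangle \<Gamma>) \<in> K4t_axioms"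

definition KD4t_axioms :: "'v fm set"
  where "KD4t_axioms = K4t_axioms \<union> {Dia Top}"

definition S4t_axioms :: "'v fm set"
  where "S4t_axioms = K4t_axioms \<union> {\<phi> \<^bold>\<longrightarrow> Dia \<phi> | \<phi>. True}"

inductive_set U_axioms :: "'v fm set" where
  "All (\<phi> \<^bold>\<longrightarrow> \<psi>) \<^bold>\<longrightarrow> (All \<phi> \<^bold>\<longrightarrow> All \<psi>) \<in> U_axioms"
| "All \<phi> \<^bold>\<longrightarrow> \<phi> \<in> U_axioms"
| "All \<phi> \<^bold>\<longrightarrow> All (All \<phi>) \<in> U_axioms"
| "\<phi> \<^bold>\<longrightarrow> All (Ex_fm \<phi>) \<in> U_axioms"
| "All \<phi> \<^bold>\<longrightarrow> Box \<phi> \<in> U_axioms"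

definition C_axioms :: "'v fm set"
  where "C_axioms =
    {All (BoxStar \<phi> \<^bold>\<or> BoxStar (Neg \<phi>)) \<^bold>\<longrightarrow> (All \<phi> \<^bold>\<or> All (Neg \<phi>)) | \<phi>. True}"

text \<open>Theorems of the system with axioms \<open>A\<close> in the language \<open>L\<close>; all formulas in a derivation
  belong to \<open>L\<close>. The side condition of \<open>Gen\<close> makes this a rule only when \<open>L\<close> is \<open>L_BoxAll\<close>,
  since \<open>L_Box\<close> contains no formula \<open>All \<phi>\<close>.\<close>

inductive_set thms :: "'v fm set \<Rightarrow> 'v fm set \<Rightarrow> 'v fm set"
  for L :: "'v fm set" and A :: "'v fm set" where
  Ax: "\<phi> \<in> A \<Longrightarrow> \<phi> \<in> L \<Longrightarrow> \<phi> \<in> thms L A"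
| MP: "\<phi> \<^bold>\<longrightarrow> \<psi> \<in> thms L A \<Longrightarrow> \<phi> \<in> thms L A \<Longrightarrow> \<psi> \<in> thms L A"
| Nec: "\<phi> \<in> thms L A \<Longrightarrow> Box \<phi> \<in> thms L A"
| Gen: "\<phi> \<in> thms L A \<Longrightarrow> All \<phi> \<in> L \<Longrightarrow> All \<phi> \<in> thms L A"

definition K4t :: "'v fm set" where "K4t = thms L_Box K4t_axioms"
definition KD4t :: "'v fm set" where "KD4t = thms L_Box KD4t_axioms"
definition S4t :: "'v fm set" where "S4t = thms L_Box S4t_axioms"

definition K4tU :: "'v fm set" where "K4tU = thms L_BoxAll (K4t_axioms \<union> U_axioms)"
definition KD4tU :: "'v fm set" where "KD4tU = thms L_BoxAll (KD4t_axioms \<union> U_axioms)"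
definition S4tU :: "'v fm set" where "S4tU = thms L_BoxAll (S4t_axioms \<union> U_axioms)"

definition K4tUC :: "'v fm set"
  where "K4tUC = thms L_BoxAll (K4t_axioms \<union> U_axioms \<union> C_axioms)"
definition KD4tUC :: "'v fm set"
  where "KD4tUC = thms L_BoxAll (KD4t_axioms \<union> U_axioms \<union> C_axioms)"
definition S4tUC :: "'v fm set"
  where "S4tUC = thms L_BoxAll (S4t_axioms \<union> U_axioms \<union> C_axioms)"

definition consistent :: "'v fm set \<Rightarrow> 'v fm \<Rightarrow> bool"
  where "consistent H \<phi> \<longleftrightarrow> Neg \<phi> \<notin> H"

text \<open>\<open>H\<close> is the set of theorems of a system in the language \<open>L\<close>. Worlds are natural numbers, which
  is no restriction because every finite frame is isomorphic to one on a set of naturals.\<close>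

definition fmp_over :: "'v fm set \<Rightarrow> 'v fm set \<Rightarrow> (nat set \<Rightarrow> nat rel \<Rightarrow> bool) \<Rightarrow> bool"
  where "fmp_over L H K \<longleftrightarrow>
    (\<forall>\<phi>\<in>L. consistent H \<phi> \<longrightarrow>
       (\<exists>W R h. finite W \<and> frame W R \<and> K W R \<and> (\<forall>p. h p \<subseteq> W) \<and>
          (\<exists>w\<in>W. sat W R h w \<phi>)))"

end

theory Submission
  imports Defs "HOL-Library.Infinite_Set"
begin

text \<open>Fix a consistent formula \<open>\<phi>\<close> and let \<open>\<Phi>\<close> be the finite set of subformulas of
  \<open>\<box>\<bottom> \<and> \<phi>\<close>. In the canonical frame, whose points are the maximal consistent sets, the truth
  lemma for \<open>\<langle>t\<rangle>\<close> can fail, and filtration through \<open>\<Phi>\<close> does not restore it: points \<open>x\<close> and \<open>y\<close> of the same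
  type (the same intersection with \<open>\<Phi>\<close>) get identified, and this can create clusters that satisfy all of
  some \<open>\<Gamma>\<close> although \<open>\<langle>t\<rangle>\<Gamma>\<close> was false. The remedy is to control the clusters.

  Besides its type, a point \<open>x\<close> of the canonical frame gets the set \<open>sees x\<close> of the types of its
  successors. This set can only shrink along the accessibility relation. The worlds of the finite model
  are the pairs (type of \<open>x\<close>, \<open>sees x\<close>). For each value \<open>S\<close> of \<open>sees\<close> choose one point \<open>rep S\<close> having it;
  \<open>core S\<close> consists of the types in \<open>S\<close> that occur above \<open>rep S\<close> only at points where \<open>sees\<close> is still \<open>S\<close>.
  A world with second component \<open>S\<close> sees \<open>core S \<times> {S}\<close>, which becomes a cluster, and those worlds with smaller
  second component whose type is compatible with its own (\<open>above\<close>). A type in \<open>S\<close> outside \<open>core S\<close> occurs by definition with a smaller second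
  component, so all diamonds have witnesses.

  The core is what makes the truth lemma for \<open>\<langle>t\<rangle>\<close> work, in both directions.
  If each member of \<open>\<Gamma>\<close> belongs to a type in \<open>core S\<close>, then ``the type is in \<open>core S\<close>'' is expressible by a
  formula which above \<open>rep S\<close> implies that each \<open>\<gamma> \<in> \<Gamma>\<close> together with this formula is possible; so (Ind) puts
  \<open>\<langle>t\<rangle>\<Gamma>\<close> into the types in \<open>core S\<close> (\<open>core_tangle\<close>). As \<open>S\<close> can only change finitely often, an
  infinite path in the model ends up in one core (or in a loop, see below), which gives \<open>tangle_sound\<close>.
  Conversely, suppose that \<open>\<langle>t\<rangle>\<Gamma> \<in> x\<close>. If above \<open>rep (sees x)\<close> some point contains \<open>\<langle>t\<rangle>\<Gamma>\<close> and sees less, go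
  there and use induction. If not, then every type in \<open>sees x\<close> containing \<open>\<langle>t\<rangle>\<Gamma>\<close> is in the core, and by (Fix) these
  types include one containing \<open>\<gamma>\<close> for each \<open>\<gamma> \<in> \<Gamma>\<close> (\<open>tangle_complete\<close>).

  For \<open>\<forall>\<close> only the points of one class of the canonical equivalence relation are used. For reflexive
  frames loops are added; a looping world that satisfies all of \<open>\<Gamma>\<close> has \<open>\<langle>t\<rangle>\<Gamma>\<close> by (Ind) with
  the conjunction of \<open>\<Gamma>\<close> (\<open>loop_tangle\<close>). For path-connected frames, ``smaller'' is taken in
  a linear order extending strict inclusion. Then two worlds of the same type have a common successor,
  unless they are equal, so that each component of the model is described by a set of types,
  and the connectedness axiom applied to this set says that there is only one component.\<close>

section \<open>Propositional reasoning\<close>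

text \<open>Formulas that are not Boolean compounds act as propositional atoms here. A tautology in this sense is an
  instance of a tautology over numbered variables because a formula has finitely many such parts
  (\<open>tautology_axiom\<close>).\<close>
fun bev :: "('v fm \<Rightarrow> bool) \<Rightarrow> 'v fm \<Rightarrow> bool" where
  "bev v Top = True"
| "bev v (Neg \<phi>) = (\<not> bev v \<phi>)"
| "bev v (\<phi> \<^bold>\<and> \<psi>) = (bev v \<phi> \<and> bev v \<psi>)"
| "bev v \<phi> = v \<phi>"

fun prime_parts :: "'v fm \<Rightarrow> 'v fm set" where
  "prime_parts Top = {}"
| "prime_parts (Neg \<phi>) = prime_parts \<phi>"
| "prime_parts (\<phi> \<^bold>\<and> \<psi>) = prime_parts \<phi> \<union> prime_parts \<psi>"
| "prime_parts \<phi> = {\<phi>}"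

fun abstract :: "('v fm \<Rightarrow> nat) \<Rightarrow> 'v fm \<Rightarrow> pfm" where
  "abstract f Top = PTop"
| "abstract f (Neg \<phi>) = PNeg (abstract f \<phi>)"
| "abstract f (\<phi> \<^bold>\<and> \<psi>) = PAnd (abstract f \<phi>) (abstract f \<psi>)"
| "abstract f \<phi> = PVar (f \<phi>)"

lemma finite_prime_parts: "finite (prime_parts \<phi>)"
  by (induction \<phi> rule: prime_parts.induct) auto

lemma peval_abstract: "peval e (abstract f \<phi>) = bev (e \<circ> f) \<phi>"
  by (induction f \<phi> rule: abstract.induct) auto

lemma psubst_abstract:
  "(\<And>\<psi>. \<psi> \<in> prime_parts \<phi> \<Longrightarrow> \<sigma> (f \<psi>) = \<psi>) \<Longrightarrow> psubst \<sigma> (abstract f \<phi>) = \<phi>"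
  by (induction \<phi> rule: prime_parts.induct) auto

lemma tautology_axiom:
  assumes "\<And>v. bev v \<phi>"
  shows "\<phi> \<in> K4t_axioms"
proof -
  obtain f :: "'a fm \<Rightarrow> nat" where f: "inj_on f (prime_parts \<phi>)"
    using finite_imp_inj_to_nat_seg[OF finite_prime_parts[of \<phi>]] by metis
  have "psubst (inv_into (prime_parts \<phi>) f) (abstract f \<phi>) = \<phi>"
    using f by (intro psubst_abstract) simp
  moreover have "psubst (inv_into (prime_parts \<phi>) f) (abstract f \<phi>) \<in> K4t_axioms"
    by (rule K4t_axioms.Taut) (simp add: peval_abstract assms)
  ultimately show ?thesis by simp
qed

lemma bev_foldr_Imp [simp]:
  "bev v (foldr Imp \<psi>s \<phi>) \<longleftrightarrow> ((\<forall>\<psi>\<in>set \<psi>s. bev v \<psi>) \<longrightarrow> bev v \<phi>)"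
  by (induction \<psi>s) auto

section \<open>Maximal consistent sets\<close>

text \<open>The closure conditions are those shared by the languages with and without \<open>\<forall>\<close>. In the latter
  everything about \<open>\<forall>\<close> holds vacuously, so that all nine systems are instances.\<close>
locale tangle_logic =
  fixes L A :: "'v fm set"
  assumes Top_L [simp]: "Top \<in> L"
    and Neg_L [simp]: "Neg \<phi> \<in> L \<longleftrightarrow> \<phi> \<in> L"
    and And_L [simp]: "\<phi> \<^bold>\<and> \<psi> \<in> L \<longleftrightarrow> \<phi> \<in> L \<and> \<psi> \<in> L"
    and Box_L [simp]: "Box \<phi> \<in> L \<longleftrightarrow> \<phi> \<in> L"
    and Tangle_L [simp]: "Tangle \<Gamma> \<in> L \<longleftrightarrow> \<Gamma> \<noteq> {||} \<and> (\<forall>\<gamma>\<in>fset \<Gamma>. \<gamma> \<in> L)"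
    and All_LD: "All \<phi> \<in> L \<Longrightarrow> \<phi> \<in> L"
    and All_L: "All \<phi> \<in> L \<Longrightarrow> \<psi> \<in> L \<Longrightarrow> All \<psi> \<in> L"
    and K4t_A: "K4t_axioms \<inter> L \<subseteq> A"
    and U_A: "U_axioms \<inter> L \<subseteq> A"
begin

abbreviation provable :: "'v fm \<Rightarrow> bool" ("\<turnstile> _" [40] 40)
  where "\<turnstile> \<phi> \<equiv> \<phi> \<in> thms L A"

lemma provable_in_L: "\<turnstile> \<phi> \<Longrightarrow> \<phi> \<in> L"
  by (induction rule: thms.induct) auto

lemma K4t_provable: "\<phi> \<in> K4t_axioms \<Longrightarrow> \<phi> \<in> L \<Longrightarrow> \<turnstile> \<phi>"
  using K4t_A by (blast intro: thms.Ax)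

lemma U_provable: "\<phi> \<in> U_axioms \<Longrightarrow> \<phi> \<in> L \<Longrightarrow> \<turnstile> \<phi>"
  using U_A by (blast intro: thms.Ax)

lemma foldr_Imp_L [simp]: "foldr Imp \<psi>s \<phi> \<in> L \<longleftrightarrow> set \<psi>s \<subseteq> L \<and> \<phi> \<in> L"
  by (induction \<psi>s) auto

lemma foldr_MP: "\<turnstile> foldr Imp \<psi>s \<phi> \<Longrightarrow> (\<And>\<psi>. \<psi> \<in> set \<psi>s \<Longrightarrow> \<turnstile> \<psi>) \<Longrightarrow> \<turnstile> \<phi>"
  by (induction \<psi>s) (auto intro: thms.MP)

text \<open>Checking a semantic consequence of known theorems takes the place of writing out Hilbert-style
  derivations.\<close>
lemma propositional:
  assumes "\<And>\<psi>. \<psi> \<in> set \<psi>s \<Longrightarrow> \<turnstile> \<psi>" "\<phi> \<in> L"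
    and "\<And>v. (\<forall>\<psi>\<in>set \<psi>s. bev v \<psi>) \<Longrightarrow> bev v \<phi>"
  shows "\<turnstile> \<phi>"
proof (rule foldr_MP)
  show "\<turnstile> foldr Imp \<psi>s \<phi>"
    using assms provable_in_L by (intro K4t_provable tautology_axiom) auto
qed (use assms in auto)

definition con :: "'v fm set \<Rightarrow> bool"
  where "con X \<longleftrightarrow> (\<forall>\<psi>s. set \<psi>s \<subseteq> X \<longrightarrow> \<not> (\<turnstile> foldr Imp \<psi>s (Neg Top)))"

definition MCS :: "'v fm set \<Rightarrow> bool"
  where "MCS X \<longleftrightarrow> X \<subseteq> L \<and> con X \<and> (\<forall>\<phi>\<in>L. con (insert \<phi> X) \<longrightarrow> \<phi> \<in> X)"

text \<open>The type of variables may be uncountable, so that the formulas cannot be enumerated; hence Zorn's lemma.\<close>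
lemma lindenbaum:
  assumes "X \<subseteq> L" "con X"
  shows "\<exists>Y. MCS Y \<and> X \<subseteq> Y"
proof -
  let ?F = "{Y. X \<subseteq> Y \<and> Y \<subseteq> L \<and> con Y}"
  have "\<exists>M\<in>?F. \<forall>Y\<in>?F. M \<subseteq> Y \<longrightarrow> Y = M"
  proof (rule subset_Zorn_nonempty)
    show "?F \<noteq> {}" using assms by auto
  next
    fix \<C> assume ne: "\<C> \<noteq> {}" and ch: "subset.chain ?F \<C>"
    have sub: "\<C> \<subseteq> ?F" using ch by (simp add: subset.chain_def)
    have "con (\<Union>\<C>)"
      unfolding con_def
    proof (intro allI impI)
      fix \<psi>s assume "set \<psi>s \<subseteq> \<Union>\<C>"
      then obtain Y where "Y \<in> \<C>" "set \<psi>s \<subseteq> Y"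
        using finite_subset_Union_chain[OF _ _ ne ch] by (metis finite_set)
      then show "\<not> (\<turnstile> foldr Imp \<psi>s (Neg Top))" using sub by (auto simp: con_def)
    qed
    then show "\<Union>\<C> \<in> ?F" using sub ne by blast
  qed
  then obtain M where M: "M \<in> ?F" "\<forall>Y\<in>?F. M \<subseteq> Y \<longrightarrow> Y = M" by (rule bexE)
  have "MCS M" unfolding MCS_def
  proof (intro conjI ballI impI)
    fix \<phi> assume "\<phi> \<in> L" "con (insert \<phi> M)"
    moreover have "X \<subseteq> insert \<phi> M" "M \<subseteq> L" using M(1) by blast+
    ultimately have "insert \<phi> M \<in> ?F" by simp
    then have "insert \<phi> M = M" using bspec[OF M(2)] by (simp add: subset_insertI)
    then show "\<phi> \<in> M" by (metis insertI1)
  qed (use M in auto)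
  then show ?thesis using M(1) by auto
qed

lemma inconsistent_insert:
  assumes "\<not> con (insert \<phi> X)" "\<phi> \<in> L"
  shows "\<exists>\<psi>s. set \<psi>s \<subseteq> X \<and> (\<turnstile> foldr Imp \<psi>s (Neg \<phi>))"
proof -
  obtain \<psi>s where \<psi>s: "set \<psi>s \<subseteq> insert \<phi> X" "\<turnstile> foldr Imp \<psi>s (Neg Top)"
    using assms by (auto simp: con_def)
  let ?\<psi>s = "filter (\<lambda>\<psi>. \<psi> \<noteq> \<phi>) \<psi>s"
  have "\<turnstile> foldr Imp ?\<psi>s (Neg \<phi>)"
    by (rule propositional[where \<psi>s = "[foldr Imp \<psi>s (Neg Top)]"])
      (use \<psi>s provable_in_L[OF \<psi>s(2)] assms(2) in auto)
  then show ?thesis using \<psi>s(1) by (intro exI[of _ ?\<psi>s]) auto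
qed

lemma MCS_notin:
  assumes "MCS X" "\<phi> \<in> L" "\<phi> \<notin> X"
  shows "\<exists>\<psi>s. set \<psi>s \<subseteq> X \<and> (\<turnstile> foldr Imp \<psi>s (Neg \<phi>))"
proof (rule inconsistent_insert)
  show "\<not> con (insert \<phi> X)" using assms unfolding MCS_def by blast
qed (rule assms(2))

lemma MCS_closed:
  assumes X: "MCS X" and \<phi>: "\<turnstile> foldr Imp \<psi>s \<phi>" and \<psi>s: "set \<psi>s \<subseteq> X"
  shows "\<phi> \<in> X"
proof (rule ccontr)
  assume n: "\<phi> \<notin> X"
  have L: "\<phi> \<in> L" using provable_in_L[OF \<phi>] by simp
  then obtain \<chi>s where \<chi>s: "set \<chi>s \<subseteq> X" "\<turnstile> foldr Imp \<chi>s (Neg \<phi>)"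
    using MCS_notin[OF X _ n] by blast
  have "\<turnstile> foldr Imp (\<psi>s @ \<chi>s) (Neg Top)"
    by (rule propositional[where \<psi>s = "[foldr Imp \<psi>s \<phi>, foldr Imp \<chi>s (Neg \<phi>)]"])
      (use \<phi> \<chi>s provable_in_L[OF \<phi>] provable_in_L[OF \<chi>s(2)] in auto)
  moreover have "set (\<psi>s @ \<chi>s) \<subseteq> X" using \<psi>s \<chi>s by auto
  ultimately show False using X unfolding MCS_def con_def by blast
qed

lemma MCS_L: "MCS x \<Longrightarrow> \<phi> \<in> x \<Longrightarrow> \<phi> \<in> L"
  by (auto simp: MCS_def)

lemma MCS_thm: "MCS x \<Longrightarrow> \<turnstile> \<phi> \<Longrightarrow> \<phi> \<in> x"
  using MCS_closed[of x "[]"] by simp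

lemma MCS_taut:
  assumes "MCS x" "set \<psi>s \<subseteq> x" "\<phi> \<in> L" "\<And>v. (\<forall>\<psi>\<in>set \<psi>s. bev v \<psi>) \<Longrightarrow> bev v \<phi>"
  shows "\<phi> \<in> x"
proof (rule MCS_closed[OF assms(1) _ assms(2)])
  show "\<turnstile> foldr Imp \<psi>s \<phi>"
    using assms(2-4) assms(1)[unfolded MCS_def] by (intro K4t_provable tautology_axiom) auto
qed

lemma MCS_Neg:
  assumes "MCS x" "\<phi> \<in> L"
  shows "Neg \<phi> \<in> x \<longleftrightarrow> \<phi> \<notin> x"
proof
  assume "Neg \<phi> \<in> x"
  show "\<phi> \<notin> x"
  proof
    assume "\<phi> \<in> x"
    moreover have "\<turnstile> foldr Imp [Neg \<phi>, \<phi>] (Neg Top)"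
      using assms by (intro K4t_provable tautology_axiom) auto
    ultimately show False
      using \<open>Neg \<phi> \<in> x\<close> assms(1) unfolding MCS_def con_def
      by (metis empty_set empty_subsetI insert_subset list.simps(15))
  qed
next
  assume "\<phi> \<notin> x"
  then obtain \<psi>s where "set \<psi>s \<subseteq> x" "\<turnstile> foldr Imp \<psi>s (Neg \<phi>)"
    using MCS_notin[OF assms] by blast
  then show "Neg \<phi> \<in> x" using MCS_closed assms(1) by blast
qed

lemma MCS_Top: "MCS x \<Longrightarrow> Top \<in> x"
  by (rule MCS_taut[where \<psi>s = "[]"]) auto

lemma MCS_And:
  assumes "MCS x"
  shows "\<phi> \<^bold>\<and> \<psi> \<in> x \<longleftrightarrow> \<phi> \<in> x \<and> \<psi> \<in> x"
proof
  assume a: "\<phi> \<^bold>\<and> \<psi> \<in> x"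
  then have "\<phi> \<^bold>\<and> \<psi> \<in> L" using MCS_L assms by blast
  then show "\<phi> \<in> x \<and> \<psi> \<in> x"
    using a by (intro conjI MCS_taut[OF assms, where \<psi>s = "[\<phi> \<^bold>\<and> \<psi>]"]) auto
next
  assume "\<phi> \<in> x \<and> \<psi> \<in> x"
  moreover from this have "\<phi> \<^bold>\<and> \<psi> \<in> L" using MCS_L[OF assms] by simp
  ultimately show "\<phi> \<^bold>\<and> \<psi> \<in> x"
    by (intro MCS_taut[OF assms, where \<psi>s = "[\<phi>, \<psi>]"]) auto
qed

lemma MCS_Imp:
  assumes "MCS x" "\<phi> \<in> L" "\<psi> \<in> L"
  shows "(\<phi> \<^bold>\<longrightarrow> \<psi>) \<in> x \<longleftrightarrow> (\<phi> \<in> x \<longrightarrow> \<psi> \<in> x)"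
  using assms by (simp add: MCS_Neg MCS_And)

lemma MCS_MP: "MCS x \<Longrightarrow> \<turnstile> \<phi> \<^bold>\<longrightarrow> \<psi> \<Longrightarrow> \<phi> \<in> x \<Longrightarrow> \<psi> \<in> x"
  using MCS_Imp[of x \<phi> \<psi>] MCS_thm[of x "\<phi> \<^bold>\<longrightarrow> \<psi>"] provable_in_L[of "\<phi> \<^bold>\<longrightarrow> \<psi>"] by auto

lemma MCS_BigAnd:
  assumes "MCS x"
  shows "BigAnd \<phi>s \<in> x \<longleftrightarrow> set \<phi>s \<subseteq> x"
  using assms by (induction \<phi>s rule: BigAnd.induct) (auto simp: MCS_And MCS_Top)

lemma BigAnd_L: "BigAnd \<phi>s \<in> L \<longleftrightarrow> set \<phi>s \<subseteq> L"
  by (induction \<phi>s rule: BigAnd.induct) auto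

lemma normal_foldr:
  assumes M_L: "\<And>\<psi>. \<psi> \<in> L \<Longrightarrow> M \<psi> \<in> L"
    and M_K: "\<And>\<psi> \<chi>. \<psi> \<in> L \<Longrightarrow> \<chi> \<in> L \<Longrightarrow> \<turnstile> M (\<psi> \<^bold>\<longrightarrow> \<chi>) \<^bold>\<longrightarrow> (M \<psi> \<^bold>\<longrightarrow> M \<chi>)"
    and x: "MCS x" and \<psi>s: "\<And>\<psi>. \<psi> \<in> set \<psi>s \<Longrightarrow> M \<psi> \<in> x"
    and \<phi>: "M (foldr Imp \<psi>s \<phi>) \<in> x" and L: "\<phi> \<in> L" "set \<psi>s \<subseteq> L"
  shows "M \<phi> \<in> x"
  using \<psi>s \<phi> L
proof (induction \<psi>s)
  case (Cons \<psi> \<psi>s)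
  have "M \<psi> \<^bold>\<longrightarrow> M (foldr Imp \<psi>s \<phi>) \<in> x"
    by (rule MCS_MP[OF x M_K[of \<psi> "foldr Imp \<psi>s \<phi>"]]) (use Cons.prems in simp_all)
  then have "M (foldr Imp \<psi>s \<phi>) \<in> x"
    using Cons.prems MCS_Imp[OF x, of "M \<psi>" "M (foldr Imp \<psi>s \<phi>)"] by (simp add: M_L)
  then show ?case using Cons by auto
qed simp

text \<open>The argument is the same for \<open>\<box>\<close> and for \<open>\<forall>\<close>, so the operator is a parameter.\<close>
lemma normal_witness:
  assumes M_L: "\<And>\<psi>. \<psi> \<in> L \<Longrightarrow> M \<psi> \<in> L"
    and M_K: "\<And>\<psi> \<chi>. \<psi> \<in> L \<Longrightarrow> \<chi> \<in> L \<Longrightarrow> \<turnstile> M (\<psi> \<^bold>\<longrightarrow> \<chi>) \<^bold>\<longrightarrow> (M \<psi> \<^bold>\<longrightarrow> M \<chi>)"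
    and M_N: "\<And>\<psi>. \<turnstile> \<psi> \<Longrightarrow> \<turnstile> M \<psi>"
    and M_LD: "\<And>\<psi>. M \<psi> \<in> L \<Longrightarrow> \<psi> \<in> L"
    and x: "MCS x" and \<phi>: "\<phi> \<in> L" "M \<phi> \<notin> x"
  shows "\<exists>y. MCS y \<and> (\<forall>\<psi>. M \<psi> \<in> x \<longrightarrow> \<psi> \<in> y) \<and> \<phi> \<notin> y"
proof -
  let ?X = "{\<psi>. M \<psi> \<in> x}"
  have L: "?X \<subseteq> L" using M_LD MCS_L[OF x] by blast
  have "con (insert (Neg \<phi>) ?X)"
  proof (rule ccontr)
    assume "\<not> con (insert (Neg \<phi>) ?X)"
    then obtain \<psi>s where \<psi>s: "set \<psi>s \<subseteq> ?X" "\<turnstile> foldr Imp \<psi>s (Neg (Neg \<phi>))"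
      using inconsistent_insert[of "Neg \<phi>" ?X] \<phi> by auto
    have "\<turnstile> foldr Imp \<psi>s \<phi>"
      by (rule propositional[where \<psi>s = "[foldr Imp \<psi>s (Neg (Neg \<phi>))]"])
        (use \<psi>s provable_in_L[OF \<psi>s(2)] in auto)
    then have f: "M (foldr Imp \<psi>s \<phi>) \<in> x" using M_N MCS_thm x by blast
    have "M \<phi> \<in> x"
      by (rule normal_foldr[OF M_L M_K x _ f]) (use \<psi>s(1) \<phi>(1) L in auto)
    then show False using \<phi> by blast
  qed
  then obtain y where "MCS y" "insert (Neg \<phi>) ?X \<subseteq> y"
    using lindenbaum[of "insert (Neg \<phi>) ?X"] L \<phi> by auto
  then show ?thesis using MCS_Neg \<phi> by blast
qed

section \<open>The canonical accessibility relation\<close>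

definition acc :: "'v fm set \<Rightarrow> 'v fm set \<Rightarrow> bool"
  where "acc x y \<longleftrightarrow> MCS x \<and> MCS y \<and> (\<forall>\<phi>. Box \<phi> \<in> x \<longrightarrow> \<phi> \<in> y)"

lemma acc_MCS: "acc x y \<Longrightarrow> MCS x" "acc x y \<Longrightarrow> MCS y"
  by (auto simp: acc_def)

lemma Box_iff:
  assumes "MCS x" "\<phi> \<in> L"
  shows "Box \<phi> \<in> x \<longleftrightarrow> (\<forall>y. acc x y \<longrightarrow> \<phi> \<in> y)"
proof
  assume "\<forall>y. acc x y \<longrightarrow> \<phi> \<in> y"
  moreover have "\<exists>y. MCS y \<and> (\<forall>\<psi>. Box \<psi> \<in> x \<longrightarrow> \<psi> \<in> y) \<and> \<phi> \<notin> y" if "Box \<phi> \<notin> x"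
  proof (rule normal_witness)
    show "\<turnstile> Box (\<psi> \<^bold>\<longrightarrow> \<chi>) \<^bold>\<longrightarrow> (Box \<psi> \<^bold>\<longrightarrow> Box \<chi>)" if "\<psi> \<in> L" "\<chi> \<in> L" for \<psi> \<chi>
      using that by (intro K4t_provable K4t_axioms.K) simp
  qed (use that assms in \<open>simp_all add: thms.Nec\<close>)
  ultimately show "Box \<phi> \<in> x" using assms by (auto simp: acc_def)
qed (auto simp: acc_def)

lemma Dia_iff:
  assumes "MCS x" "\<phi> \<in> L"
  shows "Dia \<phi> \<in> x \<longleftrightarrow> (\<exists>y. acc x y \<and> \<phi> \<in> y)"
  using assms acc_MCS(2) by (auto simp: MCS_Neg Box_iff)

lemma acc_trans:
  assumes "acc x y" "acc y z"
  shows "acc x z"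
  unfolding acc_def
proof (intro conjI allI impI)
  show x: "MCS x" and z: "MCS z" using assms acc_MCS by auto
  fix \<phi> assume b: "Box \<phi> \<in> x"
  then have L: "\<phi> \<in> L" using MCS_L[OF x, of "Box \<phi>"] by simp
  show "\<phi> \<in> z"
  proof (rule ccontr)
    assume "\<phi> \<notin> z"
    then have "Neg \<phi> \<in> z" using L z MCS_Neg by blast
    then have "Dia (Neg \<phi>) \<in> y" using assms(2) L acc_MCS(2)[OF assms(1)] by (subst Dia_iff) auto
    then have "Dia (Dia (Neg \<phi>)) \<in> x" using assms(1) L x by (subst Dia_iff) auto
    moreover have "\<turnstile> Dia (Dia (Neg \<phi>)) \<^bold>\<longrightarrow> Dia (Neg \<phi>)"
      using L by (intro K4t_provable K4t_axioms.Four) auto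
    ultimately have "Dia (Neg \<phi>) \<in> x" using MCS_MP x by blast
    then obtain y' where "acc x y'" "Neg \<phi> \<in> y'" using L x by (subst (asm) Dia_iff) auto
    then show False using b L MCS_Neg by (auto simp: acc_def)
  qed
qed

lemma acc_Box: "acc x y \<Longrightarrow> Box \<phi> \<in> x \<Longrightarrow> Box \<phi> \<in> y"
  by (metis Box_L Box_iff MCS_L acc_MCS acc_trans)

lemma acc_self:
  assumes "\<And>\<phi>. \<phi> \<in> L \<Longrightarrow> \<turnstile> \<phi> \<^bold>\<longrightarrow> Dia \<phi>" and x: "MCS x"
  shows "acc x x"
proof -
  have "\<phi> \<in> x" if b: "Box \<phi> \<in> x" for \<phi>
  proof (rule ccontr)
    assume n: "\<phi> \<notin> x"
    have L: "\<phi> \<in> L" using MCS_L[OF x b] by simp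
    then have "Neg \<phi> \<in> x" using n x MCS_Neg by blast
    moreover have "\<turnstile> Neg \<phi> \<^bold>\<longrightarrow> Dia (Neg \<phi>)" using assms(1) L by simp
    ultimately have "Dia (Neg \<phi>) \<in> x" using MCS_MP x by blast
    then obtain y where "acc x y" "Neg \<phi> \<in> y" using L Dia_iff[OF x, of "Neg \<phi>"] by auto
    then show False using b L MCS_Neg by (auto simp: acc_def)
  qed
  then show ?thesis using x by (auto simp: acc_def)
qed

section \<open>Definable properties and the tangle axioms\<close>

text \<open>The axiom (Ind) speaks of a formula; the arguments below speak of a property of maximal consistent
  sets. Definability mediates between the two without writing formulas down.\<close>
definition definable :: "('v fm set \<Rightarrow> bool) \<Rightarrow> bool"
  where "definable P \<longleftrightarrow> (\<exists>\<chi>\<in>L. \<forall>x. MCS x \<longrightarrow> (\<chi> \<in> x \<longleftrightarrow> P x))"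

lemma definable_mem: "\<phi> \<in> L \<Longrightarrow> definable (\<lambda>x. \<phi> \<in> x)"
  by (auto simp: definable_def)

lemma definable_True: "definable (\<lambda>x. True)"
  unfolding definable_def by (rule bexI[of _ Top]) (auto simp: MCS_Top)

lemma definable_not: "definable P \<Longrightarrow> definable (\<lambda>x. \<not> P x)"
  unfolding definable_def by (metis MCS_Neg Neg_L)

lemma definable_conj: "definable P \<Longrightarrow> definable Q \<Longrightarrow> definable (\<lambda>x. P x \<and> Q x)"
  unfolding definable_def by (metis MCS_And And_L)

lemma definable_Ball: "finite I \<Longrightarrow> (\<And>i. i \<in> I \<Longrightarrow> definable (P i)) \<Longrightarrow> definable (\<lambda>x. \<forall>i\<in>I. P i x)"
  by (induction I rule: finite_induct) (auto intro: definable_True definable_conj)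

lemma definable_Bex: "finite I \<Longrightarrow> (\<And>i. i \<in> I \<Longrightarrow> definable (P i)) \<Longrightarrow> definable (\<lambda>x. \<exists>i\<in>I. P i x)"
  using definable_not[OF definable_Ball[of I "\<lambda>i x. \<not> P i x"]] definable_not by simp

lemma definable_type:
  assumes "finite \<Phi>" "\<Phi> \<subseteq> L" "T \<subseteq> Pow \<Phi>"
  shows "definable (\<lambda>x. x \<inter> \<Phi> \<in> T)"
proof -
  have one: "definable (\<lambda>x. x \<inter> \<Phi> = t)" if "t \<in> T" for t
  proof -
    have "definable (\<lambda>x. (\<phi> \<in> x) = (\<phi> \<in> t))" if "\<phi> \<in> \<Phi>" for \<phi>
      using definable_mem[of \<phi>] definable_not[OF definable_mem[of \<phi>]] that assms
      by (cases "\<phi> \<in> t") auto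
    then have "definable (\<lambda>x. \<forall>\<phi>\<in>\<Phi>. (\<phi> \<in> x) = (\<phi> \<in> t))"
      by (rule definable_Ball[OF assms(1)])
    moreover have "(\<lambda>x. \<forall>\<phi>\<in>\<Phi>. (\<phi> \<in> x) = (\<phi> \<in> t)) = (\<lambda>x. x \<inter> \<Phi> = t)"
      using that assms by fastforce
    ultimately show ?thesis by simp
  qed
  have "definable (\<lambda>x. \<exists>t\<in>T. x \<inter> \<Phi> = t)"
    using assms finite_subset[of T "Pow \<Phi>"] by (intro definable_Bex one) auto
  then show ?thesis by simp
qed

lemma tangle_fix:
  assumes "MCS x" "Tangle \<Gamma> \<in> x" "\<gamma> \<in> fset \<Gamma>"
  shows "\<exists>y. acc x y \<and> \<gamma> \<in> y \<and> Tangle \<Gamma> \<in> y"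
proof -
  have L: "Tangle \<Gamma> \<in> L" "\<gamma> \<in> L" using assms MCS_L[of x "Tangle \<Gamma>"] by auto
  then have "\<turnstile> Tangle \<Gamma> \<^bold>\<longrightarrow> Dia (\<gamma> \<^bold>\<and> Tangle \<Gamma>)"
    using assms by (intro K4t_provable K4t_axioms.Fix) auto
  then have "Dia (\<gamma> \<^bold>\<and> Tangle \<Gamma>) \<in> x" using MCS_MP assms by blast
  then show ?thesis using Dia_iff[of x "\<gamma> \<^bold>\<and> Tangle \<Gamma>"] L assms MCS_And acc_MCS
    by (metis And_L)
qed

lemma tangle_ind:
  assumes "Tangle \<Gamma> \<in> L" and "definable P" and x: "MCS x" "P x"
    and step: "\<And>y \<gamma>. y = x \<or> acc x y \<Longrightarrow> P y \<Longrightarrow> \<gamma> \<in> fset \<Gamma> \<Longrightarrow> \<exists>z. acc y z \<and> \<gamma> \<in> z \<and> P z"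
  shows "Tangle \<Gamma> \<in> x"
proof -
  obtain \<chi> where \<chi>: "\<chi> \<in> L" "\<And>y. MCS y \<Longrightarrow> \<chi> \<in> y \<longleftrightarrow> P y"
    using assms(2) by (auto simp: definable_def)
  obtain \<gamma>s where \<gamma>s: "set \<gamma>s = fset \<Gamma>" "distinct \<gamma>s"
    using finite_distinct_list[of "fset \<Gamma>"] by auto
  let ?B = "BigAnd (map (\<lambda>\<gamma>. Dia (\<gamma> \<^bold>\<and> \<chi>)) \<gamma>s)"
  have L: "?B \<in> L" using \<gamma>s \<chi> assms(1) by (auto simp: BigAnd_L)
  have B: "\<chi> \<^bold>\<longrightarrow> ?B \<in> y" if y: "y = x \<or> acc x y" for y
  proof -
    have m: "MCS y" using y x acc_MCS by auto
    have "Dia (\<gamma> \<^bold>\<and> \<chi>) \<in> y" if "\<chi> \<in> y" "\<gamma> \<in> set \<gamma>s" for \<gamma>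
    proof -
      obtain z where "acc y z" "\<gamma> \<in> z" "P z" using step[OF y] m \<chi> \<gamma>s \<open>\<chi> \<in> y\<close> \<open>\<gamma> \<in> set \<gamma>s\<close> by blast
      then show ?thesis
        using m \<chi> assms(1) \<gamma>s \<open>\<gamma> \<in> set \<gamma>s\<close> acc_MCS[of y z] by (subst Dia_iff) (auto simp: MCS_And)
    qed
    then show ?thesis using m L \<chi> by (auto simp: MCS_Imp MCS_BigAnd)
  qed
  have "\<chi> \<^bold>\<longrightarrow> ?B \<in> L" using L \<chi>(1) by simp
  from Box_iff[OF x(1) this] have "Box (\<chi> \<^bold>\<longrightarrow> ?B) \<in> x" using B by simp
  then have "BoxStar (\<chi> \<^bold>\<longrightarrow> ?B) \<in> x" using B[of x] MCS_And[OF x(1)] by blast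
  moreover have "\<turnstile> BoxStar (\<chi> \<^bold>\<longrightarrow> ?B) \<^bold>\<longrightarrow> (\<chi> \<^bold>\<longrightarrow> Tangle \<Gamma>)"
    using \<gamma>s L \<chi> assms(1) by (intro K4t_provable K4t_axioms.Ind) auto
  ultimately have "\<chi> \<^bold>\<longrightarrow> Tangle \<Gamma> \<in> x" using MCS_MP x by blast
  then show ?thesis using MCS_Imp \<chi> x assms(1) by blast
qed

text \<open>A point that sees a tangle has it: (Ind) applies to the formula \<open>\<diamond>\<langle>t\<rangle>\<Gamma>\<close>, because two uses
  of (Fix) lead to a point with \<open>\<gamma>\<close> from which \<open>\<langle>t\<rangle>\<Gamma>\<close> is still visible.\<close>
lemma tangle_persist:
  assumes "acc x y" "Tangle \<Gamma> \<in> y"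
  shows "Tangle \<Gamma> \<in> x"
proof (rule tangle_ind)
  show L: "Tangle \<Gamma> \<in> L" using assms acc_MCS MCS_L by blast
  show "MCS x" using assms acc_MCS by blast
  show "definable (\<lambda>z. Dia (Tangle \<Gamma>) \<in> z)" using L by (intro definable_mem) simp
  show "Dia (Tangle \<Gamma>) \<in> x" using assms L acc_MCS by (subst Dia_iff) auto
  fix z \<gamma> assume z: "z = x \<or> acc x z" "Dia (Tangle \<Gamma>) \<in> z" and \<gamma>: "\<gamma> \<in> fset \<Gamma>"
  have "MCS z" using z \<open>MCS x\<close> acc_MCS by blast
  then obtain u where u: "acc z u" "Tangle \<Gamma> \<in> u" using z L Dia_iff by blast
  then obtain v where v: "acc u v" "\<gamma> \<in> v" "Tangle \<Gamma> \<in> v" using tangle_fix[of u] \<gamma> acc_MCS by blast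
  then obtain w where "acc v w" "Tangle \<Gamma> \<in> w" using tangle_fix[of v] \<gamma> acc_MCS by blast
  then have "Dia (Tangle \<Gamma>) \<in> v" using L v acc_MCS by (subst Dia_iff) auto
  then show "\<exists>v. acc z v \<and> \<gamma> \<in> v \<and> Dia (Tangle \<Gamma>) \<in> v" using u v acc_trans by blast
qed

section \<open>The universal modality\<close>

text \<open>By the S5 axioms the sets \<open>univ x\<close> are the classes of an equivalence relation, and they are closed under
  accessibility because of \<open>\<forall>\<phi> \<longrightarrow> \<box>\<phi>\<close>.\<close>
definition univ :: "'v fm set \<Rightarrow> 'v fm set set"
  where "univ x = {y. MCS y \<and> (\<forall>\<phi>. All \<phi> \<in> x \<longrightarrow> \<phi> \<in> y)}"

lemma All_refl: "MCS x \<Longrightarrow> All \<phi> \<in> x \<Longrightarrow> \<phi> \<in> x"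
  using MCS_L[of x "All \<phi>"] All_LD[of \<phi>]
  by (intro MCS_MP[OF _ U_provable[OF U_axioms.intros(2)[of \<phi>]]]) auto

lemma All_trans: "MCS x \<Longrightarrow> All \<phi> \<in> x \<Longrightarrow> All (All \<phi>) \<in> x"
  using MCS_L[of x "All \<phi>"] All_L[of \<phi>]
  by (intro MCS_MP[OF _ U_provable[OF U_axioms.intros(3)[of \<phi>]]]) auto

lemma univ_self: "MCS x \<Longrightarrow> x \<in> univ x"
  using All_refl by (auto simp: univ_def)

lemma univ_MCS: "y \<in> univ x \<Longrightarrow> MCS y"
  by (auto simp: univ_def)

lemma univ_acc:
  assumes "MCS x" "y \<in> univ x" "acc y z"
  shows "z \<in> univ x"
proof -
  have "\<phi> \<in> z" if a: "All \<phi> \<in> x" for \<phi>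
  proof -
    have "All \<phi> \<in> y" using assms a All_trans by (auto simp: univ_def)
    moreover have "All \<phi> \<in> L" "\<phi> \<in> L" using a assms(1) MCS_L All_LD by blast+
    ultimately have "Box \<phi> \<in> y"
      using univ_MCS[OF assms(2)] by (intro MCS_MP[OF _ U_provable[OF U_axioms.intros(5)[of \<phi>]]]) auto
    then show ?thesis using assms by (auto simp: acc_def)
  qed
  then show ?thesis using acc_MCS assms by (auto simp: univ_def)
qed

lemma All_witness:
  assumes "MCS x" "All \<phi> \<in> L" "All \<phi> \<notin> x"
  shows "\<exists>y\<in>univ x. \<phi> \<notin> y"
proof -
  have "\<exists>y. MCS y \<and> (\<forall>\<psi>. All \<psi> \<in> x \<longrightarrow> \<psi> \<in> y) \<and> \<phi> \<notin> y"
  proof (rule normal_witness)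
    note L = All_L[OF assms(2)]
    show "All \<psi> \<in> L" if "\<psi> \<in> L" for \<psi> by (rule L[OF that])
    show "\<turnstile> All (\<psi> \<^bold>\<longrightarrow> \<chi>) \<^bold>\<longrightarrow> (All \<psi> \<^bold>\<longrightarrow> All \<chi>)" if "\<psi> \<in> L" "\<chi> \<in> L" for \<psi> \<chi>
      using that by (intro U_provable U_axioms.intros(1)) (simp add: L)
    show "\<turnstile> All \<psi>" if "\<turnstile> \<psi>" for \<psi>
      by (rule thms.Gen[OF that L[OF provable_in_L[OF that]]])
  qed (use assms All_LD in blast)+
  then show ?thesis by (auto simp: univ_def)
qed

lemma univ_sym:
  assumes "MCS x" "y \<in> univ x"
  shows "x \<in> univ y"
proof -
  have "\<phi> \<in> x" if a: "All \<phi> \<in> y" for \<phi>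
  proof (rule ccontr)
    assume n: "\<phi> \<notin> x"
    have y: "MCS y" using assms univ_MCS by blast
    have aL: "All \<phi> \<in> L" using a y MCS_L by blast
    have L: "\<phi> \<in> L" "All (Neg (Neg \<phi>)) \<in> L" "All (Ex_fm (Neg \<phi>)) \<in> L"
      using All_LD[OF aL] by (simp_all add: All_L[OF aL])
    have "\<turnstile> Neg \<phi> \<^bold>\<longrightarrow> All (Ex_fm (Neg \<phi>))"
      by (rule U_provable[OF U_axioms.intros(4)]) (use L in simp)
    moreover have "Neg \<phi> \<in> x" using assms n L MCS_Neg by blast
    ultimately have "All (Ex_fm (Neg \<phi>)) \<in> x" by (rule MCS_MP[OF assms(1)])
    then have "Ex_fm (Neg \<phi>) \<in> y" using assms(2) unfolding univ_def by blast
    then have "All (Neg (Neg \<phi>)) \<notin> y" using y L MCS_Neg by blast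
    then obtain z where "z \<in> univ y" "Neg (Neg \<phi>) \<notin> z" using All_witness y L by blast
    then show False using a L MCS_Neg by (auto simp: univ_def)
  qed
  then show ?thesis using assms(1) by (auto simp: univ_def)
qed

lemma univ_eq:
  assumes "MCS x" "y \<in> univ x"
  shows "univ y = univ x"
proof -
  have "univ b \<subseteq> univ a" if "MCS a" "b \<in> univ a" for a b
    using that All_trans unfolding univ_def by blast
  then show ?thesis using assms univ_sym univ_MCS by blast
qed

lemma All_iff:
  assumes "MCS x" "y \<in> univ x" "All \<phi> \<in> L"
  shows "All \<phi> \<in> y \<longleftrightarrow> (\<forall>z\<in>univ x. \<phi> \<in> z)"
proof
  assume "All \<phi> \<in> y"
  then show "\<forall>z\<in>univ x. \<phi> \<in> z" unfolding univ_eq[OF assms(1,2), symmetric] by (auto simp: univ_def)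
next
  assume "\<forall>z\<in>univ x. \<phi> \<in> z"
  then show "All \<phi> \<in> y"
    using All_witness[OF univ_MCS[OF assms(2)] assms(3)] univ_eq[OF assms(1,2)] by blast
qed

text \<open>Let \<open>\<chi>\<close> define \<open>P\<close>. Invariance makes one of \<open>\<box>\<^sup>*\<chi>\<close> and \<open>\<box>\<^sup>*\<not>\<chi>\<close> true at each point of the class, so
  the connectedness axiom makes \<open>\<forall>\<chi>\<close> or \<open>\<forall>\<not>\<chi>\<close> true, and the point \<open>a\<close> excludes the latter.\<close>
lemma connectedness:
  assumes C: "\<And>\<chi>. \<chi> \<in> L \<Longrightarrow> All \<chi> \<in> L"
    "\<And>\<chi>. \<chi> \<in> L \<Longrightarrow> \<turnstile> All (BoxStar \<chi> \<^bold>\<or> BoxStar (Neg \<chi>)) \<^bold>\<longrightarrow> (All \<chi> \<^bold>\<or> All (Neg \<chi>))"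
    and x: "MCS x" and P: "definable P"
    and inv: "\<And>y z. y \<in> univ x \<Longrightarrow> acc y z \<Longrightarrow> P y \<longleftrightarrow> P z"
    and a: "a \<in> univ x" "P a" and b: "b \<in> univ x"
  shows "P b"
proof -
  obtain \<chi> where \<chi>: "\<chi> \<in> L" "\<And>y. MCS y \<Longrightarrow> \<chi> \<in> y \<longleftrightarrow> P y"
    using P by (auto simp: definable_def)
  have \<chi>_univ: "\<chi> \<in> y \<longleftrightarrow> P y" if "y \<in> univ x" for y using \<chi> that univ_MCS by blast
  have AllL: "All (BoxStar \<chi> \<^bold>\<or> BoxStar (Neg \<chi>)) \<in> L" "All \<chi> \<in> L" "All (Neg \<chi>) \<in> L"
    using \<chi>(1) by (auto intro: C)
  have "BoxStar \<chi> \<^bold>\<or> BoxStar (Neg \<chi>) \<in> y" if y: "y \<in> univ x" for y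
  proof -
    have m: "MCS y" using y univ_MCS by blast
    have "Box \<chi> \<in> y" if "P y"
      using Box_iff[OF m \<chi>(1)] inv[OF y] that \<chi>(2) acc_MCS by blast
    moreover have "Box (Neg \<chi>) \<in> y" if "\<not> P y"
      using Box_iff[OF m, of "Neg \<chi>"] inv[OF y] that \<chi> acc_MCS by (simp add: MCS_Neg)
    ultimately show ?thesis
      using \<chi>(1) \<chi>_univ[OF y] by (simp add: MCS_Neg[OF m] MCS_And[OF m]) blast
  qed
  then have "All (BoxStar \<chi> \<^bold>\<or> BoxStar (Neg \<chi>)) \<in> x"
    using All_iff[OF x univ_self[OF x] AllL(1)] by blast
  then have "All \<chi> \<^bold>\<or> All (Neg \<chi>) \<in> x" using MCS_MP[OF x C(2)[OF \<chi>(1)]] by blast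
  then have "All \<chi> \<in> x \<or> All (Neg \<chi>) \<in> x"
    using AllL by (simp add: MCS_Neg[OF x] MCS_And[OF x])
  moreover have "All (Neg \<chi>) \<notin> x"
    using a \<chi>_univ[OF a(1)] \<chi>(1) MCS_Neg[OF univ_MCS[OF a(1)]] by (auto simp: univ_def)
  ultimately show ?thesis using b \<chi>_univ[OF b] by (auto simp: univ_def)
qed

end

section \<open>The finite model\<close>

text \<open>The rank \<open>rk\<close> puts the values of \<open>sees\<close> in a linear order extending strict inclusion. Path-connectedness
  depends on any two of them being comparable, and on \<open>dead_end\<close>, by which the type of a point tells whether
  it has successors (\<open>same_type_joined\<close>). The flag \<open>loops\<close> tells whether the frame is to be made reflexive.\<close>
locale finite_model = tangle_logic L A for L A :: "'v fm set" +
  fixes x0 \<Phi> :: "'v fm set" and rk :: "'v fm set set \<Rightarrow> nat" and loops :: bool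
  assumes x0: "MCS x0"
    and fin: "finite \<Phi>" and \<Phi>_L: "\<Phi> \<subseteq> L"
    and dead_end: "Box (Neg Top) \<in> \<Phi>"
    and Neg_\<Phi>: "\<And>\<phi>. Neg \<phi> \<in> \<Phi> \<Longrightarrow> \<phi> \<in> \<Phi>"
    and And_\<Phi>: "\<And>\<phi> \<psi>. \<phi> \<^bold>\<and> \<psi> \<in> \<Phi> \<Longrightarrow> \<phi> \<in> \<Phi> \<and> \<psi> \<in> \<Phi>"
    and Box_\<Phi>: "\<And>\<phi>. Box \<phi> \<in> \<Phi> \<Longrightarrow> \<phi> \<in> \<Phi>"
    and All_\<Phi>: "\<And>\<phi>. All \<phi> \<in> \<Phi> \<Longrightarrow> \<phi> \<in> \<Phi>"
    and Tangle_\<Phi>: "\<And>\<Gamma> \<gamma>. Tangle \<Gamma> \<in> \<Phi> \<Longrightarrow> \<gamma> \<in> fset \<Gamma> \<Longrightarrow> \<gamma> \<in> \<Phi>"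
    and rk_inj: "inj_on rk (Pow (Pow \<Phi>))"
    and rk_mono: "\<And>S S'. S' \<subseteq> Pow \<Phi> \<Longrightarrow> S \<subset> S' \<Longrightarrow> rk S < rk S'"
    and loops: "\<And>\<phi>. loops \<Longrightarrow> \<phi> \<in> L \<Longrightarrow> \<turnstile> \<phi> \<^bold>\<longrightarrow> Dia \<phi>"
begin

definition tp :: "'v fm set \<Rightarrow> 'v fm set"
  where "tp x = x \<inter> \<Phi>"

definition sees :: "'v fm set \<Rightarrow> 'v fm set set"
  where "sees x = tp ` {y. acc x y}"

definition world :: "'v fm set \<Rightarrow> 'v fm set \<times> 'v fm set set"
  where "world x = (tp x, sees x)"

definition worlds :: "('v fm set \<times> 'v fm set set) set"
  where "worlds = world ` univ x0"

definition rep :: "'v fm set set \<Rightarrow> 'v fm set"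
  where "rep S = (SOME x. x \<in> univ x0 \<and> sees x = S)"

text \<open>The types that will form the cluster at \<open>S\<close>. The values of \<open>sees\<close> above \<open>rep S\<close> are subsets of \<open>S\<close>, so a type
  in \<open>S\<close> outside the core is realised by a point that sees strictly less.\<close>
definition core :: "'v fm set set \<Rightarrow> 'v fm set set"
  where "core S = {t \<in> S. \<forall>y. acc (rep S) y \<longrightarrow> tp y = t \<longrightarrow> sees y = S}"

text \<open>Since ranks are compared in a linear order, a smaller rank alone says nothing about the formulas
  involved; this relation on types keeps boxes true upwards and tangles true downwards.\<close>
definition above :: "'v fm set \<Rightarrow> 'v fm set \<Rightarrow> bool"
  where "above t t' \<longleftrightarrow> (\<forall>\<phi>. Box \<phi> \<in> t \<longrightarrow> \<phi> \<in> t' \<and> Box \<phi> \<in> t') \<and>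
    (\<forall>\<Gamma>. Tangle \<Gamma> \<in> t' \<longrightarrow> Tangle \<Gamma> \<in> t)"

definition R :: "('v fm set \<times> 'v fm set set) rel"
  where "R = {((t, S), (t', S')). (t, S) \<in> worlds \<and> (t', S') \<in> worlds \<and> above t t' \<and>
    (rk S' < rk S \<or> S' = S \<and> (t' \<in> core S \<or> loops \<and> t' = t))}"

definition val :: "'v \<Rightarrow> ('v fm set \<times> 'v fm set set) set"
  where "val p = {w \<in> worlds. Atom p \<in> fst w}"

lemma sees_Pow: "sees x \<subseteq> Pow \<Phi>"
  by (auto simp: sees_def tp_def)

lemma sees_iff: "t \<in> sees x \<longleftrightarrow> (\<exists>y. acc x y \<and> tp y = t)"
  by (auto simp: sees_def)

lemma acc_sees: "acc x y \<Longrightarrow> tp y \<in> sees x"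
  by (auto simp: sees_def)

lemma sees_mono: "acc x y \<Longrightarrow> sees y \<subseteq> sees x"
  using acc_trans by (auto simp: sees_def)

lemma sees_less: "acc x y \<Longrightarrow> sees y \<noteq> sees x \<Longrightarrow> rk (sees y) < rk (sees x)"
  by (rule rk_mono[OF sees_Pow psubsetI[OF sees_mono]])

lemma val_worlds: "val p \<subseteq> worlds"
  by (auto simp: val_def)

lemma rep:
  assumes "x \<in> univ x0"
  shows "rep (sees x) \<in> univ x0" "sees (rep (sees x)) = sees x"
  using someI[of "\<lambda>y. y \<in> univ x0 \<and> sees y = sees x" x] assms by (auto simp: rep_def)

lemma acc_univ: "x \<in> univ x0 \<Longrightarrow> acc x y \<Longrightarrow> y \<in> univ x0"
  using univ_acc x0 by blast

lemma above_trans: "above t t' \<Longrightarrow> above t' t'' \<Longrightarrow> above t t''"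
  unfolding above_def by blast

lemma above_tp:
  assumes "acc x y"
  shows "above (tp x) (tp y)"
proof -
  have "\<phi> \<in> y" if "Box \<phi> \<in> x" for \<phi> using assms that by (simp add: acc_def)
  then show ?thesis
    using acc_Box[OF assms] tangle_persist[OF assms] Box_\<Phi> unfolding above_def tp_def by blast
qed

lemma above_sees: "t \<in> sees x \<Longrightarrow> above (tp x) t"
  using above_tp by (auto simp: sees_def)

lemma world_in: "x \<in> univ x0 \<Longrightarrow> world x \<in> worlds"
  by (simp add: worlds_def)

lemma R_worlds: "R \<subseteq> worlds \<times> worlds"
  by (auto simp: R_def)

lemma finite_worlds: "finite worlds"
proof (rule finite_subset)
  show "worlds \<subseteq> Pow \<Phi> \<times> Pow (Pow \<Phi>)"
    using sees_Pow by (auto simp: worlds_def world_def tp_def)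
qed (use fin in simp)

text \<open>Witnesses for diamonds come from successors of the representative \<open>rep (sees x)\<close> in the
  canonical frame rather than from those of \<open>x\<close> itself, since the core is defined through it: the two
  points may have different successors, but these realise the same types.\<close>
lemma R_step:
  assumes x: "x \<in> univ x0" and y: "acc (rep (sees x)) y"
    and c: "tp y \<in> core (sees x) \<or> sees y \<noteq> sees x"
  shows "(world x, world y) \<in> R"
proof -
  have t: "tp y \<in> sees x" using rep(2)[OF x] y by (auto simp: sees_def)
  have "y \<in> univ x0" using rep(1)[OF x] y acc_univ by blast
  moreover have "rk (sees y) < rk (sees x) \<or> sees y = sees x \<and> tp y \<in> core (sees x)"
    using c sees_less[OF y] y rep(2)[OF x] by (auto simp: core_def)
  ultimately show ?thesis
    using x above_sees[OF t] world_in[of x] world_in[of y] by (auto simp: R_def world_def)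
qed

lemma R_successor:
  assumes x: "x \<in> univ x0" and t: "t \<in> sees x"
  shows "\<exists>y\<in>univ x0. (world x, world y) \<in> R \<and> tp y = t"
proof -
  obtain y where y: "acc (rep (sees x)) y" "tp y = t" "t \<in> core (sees x) \<or> sees y \<noteq> sees x"
  proof (cases "t \<in> core (sees x)")
    case True
    then show ?thesis using that t rep(2)[OF x] sees_iff[of t "rep (sees x)"] by auto
  next
    case False
    then show ?thesis using that t by (auto simp: core_def)
  qed
  moreover have "y \<in> univ x0" using rep(1)[OF x] y acc_univ by blast
  ultimately show ?thesis using R_step[OF x] by blast
qed

lemma trans_R: "trans R"
proof (rule transI)
  fix u v w assume uv: "(u, v) \<in> R" and vw: "(v, w) \<in> R"
  have "above (fst u) (fst v)" "above (fst v) (fst w)" using uv vw by (auto simp: R_def)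
  then have "above (fst u) (fst w)" by (rule above_trans)
  then show "(u, w) \<in> R" using uv vw by (auto simp: R_def)
qed

lemma refl_R:
  assumes "loops" "w \<in> worlds"
  shows "(w, w) \<in> R"
proof -
  obtain x where x: "x \<in> univ x0" "w = world x" using assms(2) by (auto simp: worlds_def)
  have "acc x x" using acc_self loops assms(1) univ_MCS x(1) by blast
  then have "above (tp x) (tp x)" by (rule above_tp)
  then show ?thesis unfolding R_def x(2) using world_in[OF x(1)] assms(1) by (simp add: world_def)
qed

lemma serial_R:
  assumes "\<turnstile> Dia Top" "w \<in> worlds"
  shows "\<exists>v\<in>worlds. (w, v) \<in> R"
proof -
  obtain x where x: "x \<in> univ x0" "w = world x" using assms(2) by (auto simp: worlds_def)
  have "Dia Top \<in> x" using assms(1) MCS_thm univ_MCS x(1) by blast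
  then obtain y where "acc x y" using Dia_iff[OF univ_MCS[OF x(1)], of Top] by auto
  then show ?thesis using R_successor[OF x(1)] x world_in by (fastforce simp: sees_def)
qed

lemma R_path_stabilises:
  assumes s: "\<And>n. (s n, s (Suc n)) \<in> R"
  obtains N S where "\<And>n. n \<ge> N \<Longrightarrow> snd (s n) = S"
proof -
  have "rk (snd (s (Suc n))) \<le> rk (snd (s n))" for n
    using s[of n] by (auto simp: R_def)
  then have anti: "rk (snd (s n)) \<le> rk (snd (s m))" if "m \<le> n" for m n
    using lift_Suc_antimono_le[of "\<lambda>n. rk (snd (s n))"] that by blast
  obtain N where N: "\<And>n. rk (snd (s N)) \<le> rk (snd (s n))"
    using ex_has_least_nat[of "\<lambda>n. True" 0 "\<lambda>n. rk (snd (s n))"] by auto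
  have "snd (s n) = snd (s N)" if "n \<ge> N" for n
  proof -
    have Pow: "snd (s k) \<in> Pow (Pow \<Phi>)" for k
    proof -
      have "s k \<in> worlds" using s[of k] R_worlds by blast
      then obtain x where "s k = world x" by (auto simp: worlds_def)
      then show ?thesis by (simp add: world_def sees_Pow)
    qed
    have "rk (snd (s n)) = rk (snd (s N))" using anti[OF that] N[of n] by simp
    then show ?thesis by (rule inj_onD[OF rk_inj _ Pow Pow])
  qed
  then show ?thesis using that by blast
qed

text \<open>A point above \<open>rep S\<close> with a type in the core sees all types in \<open>S\<close>, in particular those in the core,
  so \<open>tangle_ind\<close> applies to the property of having a type in the core.\<close>
lemma core_tangle:
  assumes x: "x \<in> univ x0" and \<Gamma>: "Tangle \<Gamma> \<in> \<Phi>"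
    and hit: "\<And>\<gamma>. \<gamma> \<in> fset \<Gamma> \<Longrightarrow> \<exists>t\<in>core (sees x). \<gamma> \<in> t"
    and t: "t \<in> core (sees x)"
  shows "Tangle \<Gamma> \<in> t"
proof -
  let ?S = "sees x"
  have sub: "core ?S \<subseteq> ?S" by (auto simp: core_def)
  obtain y where y: "acc (rep ?S) y" "tp y = t"
    using subsetD[OF sub t] rep(2)[OF x] sees_iff[of t "rep ?S"] by auto
  have "Tangle \<Gamma> \<in> y"
  proof (rule tangle_ind)
    show "Tangle \<Gamma> \<in> L" using \<Gamma> \<Phi>_L by blast
    show "definable (\<lambda>z. tp z \<in> core ?S)"
      unfolding tp_def by (rule definable_type[OF fin \<Phi>_L subset_trans[OF sub sees_Pow]])
    show "MCS y" using y acc_MCS by blast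
    show "tp y \<in> core ?S" using y t by simp
    fix z \<gamma> assume z: "z = y \<or> acc y z" "tp z \<in> core ?S" and \<gamma>: "\<gamma> \<in> fset \<Gamma>"
    have "acc (rep ?S) z" using z y acc_trans by blast
    then have "sees z = ?S" using z by (auto simp: core_def)
    moreover obtain t' where t': "t' \<in> core ?S" "\<gamma> \<in> t'" using hit \<gamma> by blast
    ultimately have "t' \<in> sees z" using sub by blast
    then obtain u where "acc z u" "tp u = t'" unfolding sees_iff by blast
    then show "\<exists>u. acc z u \<and> \<gamma> \<in> u \<and> tp u \<in> core ?S" using t' by (auto simp: tp_def)
  qed
  then show ?thesis using y \<Gamma> by (auto simp: tp_def)
qed

lemma loop_tangle:
  assumes loops and x: "x \<in> univ x0" and \<Gamma>: "Tangle \<Gamma> \<in> \<Phi>"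
    and hit: "\<And>\<gamma>. \<gamma> \<in> fset \<Gamma> \<Longrightarrow> \<gamma> \<in> tp x"
  shows "Tangle \<Gamma> \<in> tp x"
proof -
  have "Tangle \<Gamma> \<in> x"
  proof (rule tangle_ind)
    show L: "Tangle \<Gamma> \<in> L" using \<Gamma> \<Phi>_L by blast
    show "definable (\<lambda>z. \<forall>\<gamma>\<in>fset \<Gamma>. \<gamma> \<in> z)"
      using L by (intro definable_Ball definable_mem) auto
    show m: "MCS x" using x univ_MCS by blast
    show "\<forall>\<gamma>\<in>fset \<Gamma>. \<gamma> \<in> x" using hit by (auto simp: tp_def)
    fix z \<gamma> assume z: "z = x \<or> acc x z" "\<forall>\<gamma>\<in>fset \<Gamma>. \<gamma> \<in> z" "\<gamma> \<in> fset \<Gamma>"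
    then have "acc z z" using acc_self loops \<open>loops\<close> acc_MCS m by blast
    then show "\<exists>u. acc z u \<and> \<gamma> \<in> u \<and> (\<forall>\<gamma>\<in>fset \<Gamma>. \<gamma> \<in> u)" using z by blast
  qed
  then show ?thesis using \<Gamma> by (auto simp: tp_def)
qed

text \<open>Along a path the second component becomes constant, say \<open>S\<close>. A path that then meets \<open>core S\<close>
  stays in it; one that never does can only use a loop. Either way some world on the path has the tangle,
  and tangles propagate backwards along the path.\<close>
lemma tangle_sound:
  assumes s: "\<And>n. (s n, s (Suc n)) \<in> R" and \<Gamma>: "Tangle \<Gamma> \<in> \<Phi>"
    and inf: "\<And>\<gamma>. \<gamma> \<in> fset \<Gamma> \<Longrightarrow> infinite {n. \<gamma> \<in> fst (s n)}"
  shows "Tangle \<Gamma> \<in> fst (s 0)"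
proof -
  obtain N S where N: "\<And>n. n \<ge> N \<Longrightarrow> snd (s n) = S" using R_path_stabilises[of s] s by metis
  have wd: "\<exists>x\<in>univ x0. s n = world x" for n
    using s[of n] R_worlds unfolding worlds_def by blast
  have often: "\<exists>m>n. \<gamma> \<in> fst (s m)" if "\<gamma> \<in> fset \<Gamma>" for \<gamma> n
    using inf[OF that] unfolding infinite_nat_iff_unbounded by blast
  have next_type: "fst (s (Suc n)) \<in> core S \<or> loops \<and> fst (s (Suc n)) = fst (s n)" if "n \<ge> N" for n
    using s[of n] N[OF that] N[of "Suc n"] that by (auto simp: R_def)
  have "\<exists>n. Tangle \<Gamma> \<in> fst (s n)"
  proof (cases "\<exists>n\<ge>N. fst (s n) \<in> core S")
    case True
    then obtain n where n: "n \<ge> N" "fst (s n) \<in> core S" by blast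
    have c: "fst (s m) \<in> core S" if "m \<ge> n" for m
      using that
    proof (induction m rule: dec_induct)
      case (step m)
      then show ?case using next_type[of m] n(1) by auto
    qed (rule n(2))
    obtain x where x: "x \<in> univ x0" "s n = world x" using wd by blast
    then have S: "S = sees x" using N[OF n(1)] by (simp add: world_def)
    have "Tangle \<Gamma> \<in> fst (s n)"
      using core_tangle[OF x(1) \<Gamma>] often[of _ n] c n(2) unfolding S by (meson less_imp_le)
    then show ?thesis by blast
  next
    case False
    then have l: "loops \<and> fst (s (Suc n)) = fst (s n)" if "n \<ge> N" for n
      using next_type[OF that] that by auto
    have c: "fst (s m) = fst (s N)" if "m \<ge> N" for m
      using that by (induction m rule: dec_induct) (use l in auto)
    obtain x where x: "x \<in> univ x0" "s N = world x" using wd by blast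
    have "Tangle \<Gamma> \<in> tp x"
    proof (rule loop_tangle[OF _ x(1) \<Gamma>])
      show loops using l by blast
      fix \<gamma> assume "\<gamma> \<in> fset \<Gamma>"
      then obtain m where "m > N" "\<gamma> \<in> fst (s m)" using often by blast
      then show "\<gamma> \<in> tp x" using c[of m] x by (simp add: world_def)
    qed
    then show ?thesis using x by (auto simp: world_def intro!: exI[of _ N])
  qed
  then obtain n where "Tangle \<Gamma> \<in> fst (s n)" by blast
  then show ?thesis
  proof (induction n)
    case (Suc n)
    then show ?case using s[of n] by (auto simp: R_def above_def)
  qed
qed

text \<open>Within the cluster any order of visits is possible; the path runs cyclically through types that contain
  the members of \<open>\<Gamma>\<close> in turn.\<close>
lemma tangle_cycle:
  assumes x: "x \<in> univ x0" and ne: "\<Gamma> \<noteq> {||}"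
    and hit: "\<And>\<gamma>. \<gamma> \<in> fset \<Gamma> \<Longrightarrow> \<exists>t\<in>core (sees x). \<gamma> \<in> t"
  shows "\<exists>s. s 0 = world x \<and> (\<forall>n. (s n, s (Suc n)) \<in> R) \<and>
    (\<forall>\<gamma>\<in>fset \<Gamma>. infinite {n. \<gamma> \<in> fst (s n)})"
proof -
  let ?S = "sees x"
  obtain \<gamma>s where \<gamma>s: "set \<gamma>s = fset \<Gamma>" using finite_list[OF finite_fset] by metis
  have "\<gamma>s \<noteq> []" using \<gamma>s ne by (metis bot_fset.rep_eq fset_inject set_empty2)
  then have len: "length \<gamma>s > 0" by simp
  obtain f where f: "\<And>\<gamma>. \<gamma> \<in> fset \<Gamma> \<Longrightarrow> f \<gamma> \<in> core ?S \<and> \<gamma> \<in> f \<gamma>" using hit by metis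
  define s where "s = (\<lambda>n. case n of 0 \<Rightarrow> world x | Suc m \<Rightarrow> (f (\<gamma>s ! (m mod length \<gamma>s)), ?S))"
  have f': "f (\<gamma>s ! (m mod length \<gamma>s)) \<in> core ?S" for m
    using f \<gamma>s len by (metis mod_less_divisor nth_mem)
  have core_sees: "\<exists>y\<in>univ x0. (t, ?S) = world y" if t: "t \<in> core ?S" for t
  proof -
    have "t \<in> sees (rep ?S)" using t rep(2)[OF x] by (simp add: core_def)
    then obtain y where "acc (rep ?S) y" "tp y = t" by (auto simp: sees_def)
    then show ?thesis using t rep(1)[OF x] acc_univ by (auto simp: world_def core_def)
  qed
  have wd: "\<exists>y\<in>univ x0. s n = world y \<and> sees y = ?S" for n
  proof (cases n)
    case 0
    then show ?thesis using x by (auto simp: s_def)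
  next
    case (Suc m)
    then show ?thesis using core_sees[OF f'[of m]] by (auto simp: s_def world_def)
  qed
  have "(s n, s (Suc n)) \<in> R" for n
  proof -
    obtain y where y: "y \<in> univ x0" "s n = world y" "sees y = ?S" using wd by blast
    obtain z where z: "z \<in> univ x0" "s (Suc n) = world z" "sees z = ?S" using wd by blast
    have c: "tp z \<in> core ?S" using z f'[of n] by (simp add: s_def world_def)
    then have "above (tp y) (tp z)" using y(3) above_sees by (auto simp: core_def)
    then show ?thesis
      using y z c world_in[OF y(1)] world_in[OF z(1)] by (simp add: R_def world_def)
  qed
  moreover have "infinite {n. \<gamma> \<in> fst (s n)}" if \<gamma>: "\<gamma> \<in> fset \<Gamma>" for \<gamma>
    unfolding infinite_nat_iff_unbounded
  proof
    fix m
    obtain i where i: "i < length \<gamma>s" "\<gamma>s ! i = \<gamma>" using \<gamma> \<gamma>s by (metis in_set_conv_nth)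
    have "m \<le> length \<gamma>s * m" using len by (cases "length \<gamma>s") auto
    then have "m < Suc (i + length \<gamma>s * m)" by linarith
    moreover have "\<gamma> \<in> fst (s (Suc (i + length \<gamma>s * m)))" using i f[OF \<gamma>] by (simp add: s_def)
    ultimately show "\<exists>n>m. n \<in> {n. \<gamma> \<in> fst (s n)}"
      by blast
  qed
  ultimately show ?thesis by (intro exI[of _ s]) (auto simp: s_def)
qed

text \<open>The induction is on the rank of \<open>sees x\<close>. When no point above \<open>rep (sees x)\<close> with the tangle sees less,
  every type in \<open>sees x\<close> that contains the tangle is in the core, because \<open>\<langle>t\<rangle>\<Gamma> \<in> \<Phi>\<close> makes having the tangle depend
  on the type only.\<close>
lemma tangle_complete:
  assumes "x \<in> univ x0" "Tangle \<Gamma> \<in> x" "Tangle \<Gamma> \<in> \<Phi>"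
  shows "\<exists>s. s 0 = world x \<and> (\<forall>n. (s n, s (Suc n)) \<in> R) \<and>
    (\<forall>\<gamma>\<in>fset \<Gamma>. infinite {n. \<gamma> \<in> fst (s n)})"
  using assms(1,2)
proof (induction "rk (sees x)" arbitrary: x rule: less_induct)
  case less
  let ?S = "sees x"
  note x = less.prems(1)
  \<comment> \<open>(Fix) provides a successor of \<open>x\<close>; its type is seen by \<open>rep ?S\<close> too, and the type decides
    about \<open>\<gamma>\<close> and the tangle.\<close>
  have fix_type: "\<exists>y. acc (rep ?S) y \<and> \<gamma> \<in> tp y \<and> Tangle \<Gamma> \<in> y" if \<gamma>: "\<gamma> \<in> fset \<Gamma>" for \<gamma>
  proof -
    obtain z where z: "acc x z" "\<gamma> \<in> z" "Tangle \<Gamma> \<in> z"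
      using tangle_fix[OF univ_MCS[OF x] less.prems(2) \<gamma>] by blast
    then have "tp z \<in> sees (rep ?S)" using rep(2)[OF x] by (auto simp: sees_def)
    then obtain y where "acc (rep ?S) y" "tp y = tp z" by (auto simp: sees_def)
    then show ?thesis using z assms(3) Tangle_\<Phi>[OF assms(3) \<gamma>] by (auto simp: tp_def)
  qed
  show ?case
  proof (cases "\<exists>y. acc (rep ?S) y \<and> Tangle \<Gamma> \<in> y \<and> sees y \<noteq> ?S")
    case True
    then obtain y where y: "acc (rep ?S) y" "Tangle \<Gamma> \<in> y" "sees y \<noteq> ?S" by blast
    have "rk (sees y) < rk ?S" using sees_less[OF y(1)] y(3) rep(2)[OF x] by simp
    moreover have "y \<in> univ x0" using rep(1)[OF x] y(1) acc_univ by blast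
    ultimately obtain s where s: "s 0 = world y" "\<And>n. (s n, s (Suc n)) \<in> R"
      "\<And>\<gamma>. \<gamma> \<in> fset \<Gamma> \<Longrightarrow> infinite {n. \<gamma> \<in> fst (s n)}"
      using less.hyps[of y] y(2) by blast
    let ?s = "case_nat (world x) s"
    have "(?s n, ?s (Suc n)) \<in> R" for n
      using R_step[OF x y(1)] y(3) s by (cases n) auto
    moreover have "infinite {n. \<gamma> \<in> fst (?s n)}" if "\<gamma> \<in> fset \<Gamma>" for \<gamma>
    proof
      assume "finite {n. \<gamma> \<in> fst (?s n)}"
      then have "finite (Suc -` {n. \<gamma> \<in> fst (?s n)})" by (rule finite_vimageI) simp
      then show False using s(3)[OF that] by (simp add: vimage_def)
    qed
    ultimately show ?thesis by (intro exI[of _ ?s]) auto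
  next
    case False
    have "\<exists>t\<in>core ?S. \<gamma> \<in> t" if \<gamma>: "\<gamma> \<in> fset \<Gamma>" for \<gamma>
    proof -
      obtain y where y: "acc (rep ?S) y" "\<gamma> \<in> tp y" "Tangle \<Gamma> \<in> y" using fix_type[OF \<gamma>] by blast
      have "sees z = ?S" if z: "acc (rep ?S) z" "tp z = tp y" for z
      proof -
        have "Tangle \<Gamma> \<in> tp z" unfolding z(2) using y(3) assms(3) by (simp add: tp_def)
        then show ?thesis using z(1) False by (auto simp: tp_def)
      qed
      moreover have "tp y \<in> ?S" using y(1) rep(2)[OF x] by (auto simp: sees_def)
      ultimately have "tp y \<in> core ?S" by (simp add: core_def)
      then show ?thesis using y(2) by blast
    qed
    moreover have "\<Gamma> \<noteq> {||}" using assms(3) \<Phi>_L Tangle_L by blast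
    ultimately show ?thesis using tangle_cycle[OF x] by blast
  qed
qed

theorem truth:
  "w \<in> worlds \<Longrightarrow> \<phi> \<in> \<Phi> \<Longrightarrow> sat worlds R val w \<phi> \<longleftrightarrow> \<phi> \<in> fst w"
proof (induction \<phi> arbitrary: w)
  case (Atom p)
  then show ?case by (simp add: val_def)
next
  case Top
  then show ?case using MCS_Top univ_MCS by (auto simp: worlds_def world_def tp_def)
next
  case (Neg \<phi>)
  obtain x where x: "x \<in> univ x0" "w = world x" using Neg.prems by (auto simp: worlds_def)
  have \<phi>: "\<phi> \<in> \<Phi>" by (rule Neg_\<Phi>[OF Neg.prems(2)])
  then have "Neg \<phi> \<in> x \<longleftrightarrow> \<phi> \<notin> x" using \<Phi>_L MCS_Neg[OF univ_MCS[OF x(1)]] by blast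
  then show ?case using Neg.IH[OF Neg.prems(1) \<phi>] Neg.prems x \<phi> by (simp add: world_def tp_def)
next
  case (And \<phi> \<psi>)
  obtain x where x: "x \<in> univ x0" "w = world x" using And.prems by (auto simp: worlds_def)
  have \<phi>: "\<phi> \<in> \<Phi>" "\<psi> \<in> \<Phi>" using And_\<Phi>[OF And.prems(2)] by auto
  show ?case
    using And.IH(1)[OF And.prems(1) \<phi>(1)] And.IH(2)[OF And.prems(1) \<phi>(2)] And.prems x \<phi>
      MCS_And[OF univ_MCS[OF x(1)]] by (simp add: world_def tp_def)
next
  case (Box \<phi>)
  have \<phi>: "\<phi> \<in> \<Phi>" "\<phi> \<in> L" using Box.prems Box_\<Phi> \<Phi>_L by auto
  obtain x where x: "x \<in> univ x0" "w = world x" using Box.prems by (auto simp: worlds_def)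
  show ?case
  proof
    assume "Box \<phi> \<in> fst w"
    then have "\<phi> \<in> fst v" if "(w, v) \<in> R" for v using that by (auto simp: R_def above_def)
    then show "sat worlds R val w (Box \<phi>)" using Box.IH \<phi>(1) R_worlds by auto
  next
    assume *: "sat worlds R val w (Box \<phi>)"
    have "\<phi> \<in> y" if y: "acc x y" for y
    proof -
      obtain z where "z \<in> univ x0" "(world x, world z) \<in> R" "tp z = tp y"
        using R_successor[OF x(1) acc_sees[OF y]] by blast
      then show ?thesis using * x Box.IH[OF world_in[of z] \<phi>(1)] by (auto simp: world_def tp_def)
    qed
    then have "Box \<phi> \<in> x" using Box_iff[OF univ_MCS[OF x(1)] \<phi>(2)] by blast
    then show "Box \<phi> \<in> fst w" using x Box.prems by (simp add: world_def tp_def)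
  qed
next
  case (All \<phi>)
  have \<phi>: "\<phi> \<in> \<Phi>" "All \<phi> \<in> L" using All.prems All_\<Phi> \<Phi>_L by auto
  obtain x where x: "x \<in> univ x0" "w = world x" using All.prems by (auto simp: worlds_def)
  have "All \<phi> \<in> fst w \<longleftrightarrow> (\<forall>z\<in>univ x0. \<phi> \<in> z)"
    using All_iff[OF x0 x(1) \<phi>(2)] x All.prems by (simp add: world_def tp_def)
  also have "\<dots> \<longleftrightarrow> (\<forall>v\<in>worlds. \<phi> \<in> fst v)" using \<phi>(1) by (auto simp: worlds_def world_def tp_def)
  also have "\<dots> \<longleftrightarrow> sat worlds R val w (All \<phi>)" using All.IH \<phi>(1) by auto
  finally show ?case by blast
next
  case (Tangle \<Gamma>)
  obtain x where x: "x \<in> univ x0" "w = world x" using Tangle.prems by (auto simp: worlds_def)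
  have set_eq: "{n. sat worlds R val (s n) \<gamma>} = {n. \<gamma> \<in> fst (s n)}"
    if s: "\<forall>n. (s n, s (Suc n)) \<in> R" and \<gamma>: "\<gamma> \<in> fset \<Gamma>" for s \<gamma>
  proof -
    have "s n \<in> worlds" for n using s R_worlds by blast
    then show ?thesis using Tangle.IH \<gamma> Tangle_\<Phi> Tangle.prems(2) by blast
  qed
  have "sat worlds R val w (Tangle \<Gamma>) \<longleftrightarrow> (\<exists>s. s 0 = w \<and> (\<forall>n. (s n, s (Suc n)) \<in> R) \<and>
      (\<forall>\<gamma>\<in>fset \<Gamma>. infinite {n. \<gamma> \<in> fst (s n)}))"
    unfolding sat.simps using set_eq by (intro ex_cong1) auto
  also have "\<dots> \<longleftrightarrow> Tangle \<Gamma> \<in> fst w"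
  proof
    assume "Tangle \<Gamma> \<in> fst w"
    then have "Tangle \<Gamma> \<in> x" using x by (simp add: world_def tp_def)
    then show "\<exists>s. s 0 = w \<and> (\<forall>n. (s n, s (Suc n)) \<in> R) \<and>
      (\<forall>\<gamma>\<in>fset \<Gamma>. infinite {n. \<gamma> \<in> fst (s n)})"
      using tangle_complete[OF x(1) _ Tangle.prems(2)] x(2) by simp
  qed (use tangle_sound[OF _ Tangle.prems(2)] in blast)
  finally show ?case .
qed

abbreviation joined :: "('v fm set \<times> 'v fm set set) rel"
  where "joined \<equiv> (R \<union> R\<inverse>)\<^sup>*"

lemma joined_sym: "(u, v) \<in> joined \<Longrightarrow> (v, u) \<in> joined"
  by (metis converse_Un converse_converse rtrancl_converseD rtrancl_converseI sup_commute)

text \<open>If the two worlds differ, their ranks differ by injectivity. The one of smaller rank has a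
  successor, since otherwise its type would contain \<open>\<box>\<bottom>\<close> and the other one would see nothing either. That
  successor is also one of the world of larger rank, since the types agree.\<close>
lemma same_type_joined:
  assumes "x \<in> univ x0" "y \<in> univ x0" "tp x = tp y"
  shows "(world x, world y) \<in> joined"
proof -
  have *: "(world x, world y) \<in> joined"
    if x: "x \<in> univ x0" and y: "y \<in> univ x0" and t: "tp x = tp y" and less: "rk (sees x) < rk (sees y)"
    for x y
  proof -
    have "sees x \<noteq> {}"
    proof
      assume e: "sees x = {}"
      then have "Box (Neg Top) \<in> x" using Box_iff[OF univ_MCS[OF x]] by (auto simp: sees_def)
      then have "Box (Neg Top) \<in> y" using t dead_end by (auto simp: tp_def)
      then have "Neg Top \<in> z" if "acc y z" for z using that by (auto simp: acc_def)
      then have "sees y = {}" using acc_MCS MCS_Neg MCS_Top by (fastforce simp: sees_def)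
      then show False using e less by simp
    qed
    then obtain z where z: "z \<in> univ x0" "(world x, world z) \<in> R"
      using R_successor[OF x] by blast
    have "above (tp y) (tp z)" "rk (sees z) < rk (sees y)"
      using z(2) t less by (auto simp: R_def world_def)
    then have "(world y, world z) \<in> R"
      using world_in[OF y] world_in[OF z(1)] by (simp add: R_def world_def)
    then have "(world x, world z) \<in> R \<union> R\<inverse>" "(world z, world y) \<in> R \<union> R\<inverse>" using z(2) by auto
    then show ?thesis by (meson rtrancl.rtrancl_into_rtrancl r_into_rtrancl)
  qed
  consider "rk (sees x) < rk (sees y)" | "rk (sees y) < rk (sees x)" | "sees x = sees y"
    using rk_inj sees_Pow by (metis PowI inj_on_def linorder_neqE_nat)
  then show ?thesis
  proof cases
    case 1
    then show ?thesis using * assms by blast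
  next
    case 2
    then have "(world y, world x) \<in> joined" using * assms by simp
    then show ?thesis by (rule joined_sym)
  next
    case 3
    then show ?thesis using assms by (simp add: world_def)
  qed
qed

lemma acc_joined:
  assumes "x \<in> univ x0" "acc x y"
  shows "(world x, world y) \<in> joined"
proof -
  obtain z where "z \<in> univ x0" "(world x, world z) \<in> R" "tp z = tp y"
    using R_successor[OF assms(1) acc_sees[OF assms(2)]] by blast
  then show ?thesis
    using same_type_joined[of z y] acc_univ[OF assms] by (meson UnCI converse_rtrancl_into_rtrancl)
qed

text \<open>By \<open>same_type_joined\<close> a component is determined by the types occurring in it, and by \<open>acc_joined\<close>
  having one of these types is invariant along accessibility; so \<open>connectedness\<close> applies.\<close>
lemma path_connected_R:
  assumes C: "\<And>\<chi>. \<chi> \<in> L \<Longrightarrow> All \<chi> \<in> L"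
    "\<And>\<chi>. \<chi> \<in> L \<Longrightarrow> \<turnstile> All (BoxStar \<chi> \<^bold>\<or> BoxStar (Neg \<chi>)) \<^bold>\<longrightarrow> (All \<chi> \<^bold>\<or> All (Neg \<chi>))"
  shows "path_connected_on worlds R"
  unfolding path_connected_on_def
proof (intro ballI)
  fix u v assume uv: "u \<in> worlds" "v \<in> worlds"
  then obtain a b where ab: "a \<in> univ x0" "u = world a" "b \<in> univ x0" "v = world b"
    by (auto simp: worlds_def)
  define T where "T = tp ` {x \<in> univ x0. (u, world x) \<in> joined}"
  have T: "tp x \<in> T \<longleftrightarrow> (u, world x) \<in> joined" if x: "x \<in> univ x0" for x
  proof
    assume "tp x \<in> T"
    then obtain y where "y \<in> univ x0" "(u, world y) \<in> joined" "tp y = tp x" by (auto simp: T_def)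
    then show "(u, world x) \<in> joined" using same_type_joined[of y x] x by (meson rtrancl_trans)
  qed (use x in \<open>auto simp: T_def\<close>)
  have "tp b \<in> T"
  proof (rule connectedness[OF C x0, where P = "\<lambda>x. tp x \<in> T"])
    show "definable (\<lambda>x. tp x \<in> T)"
      unfolding tp_def by (rule definable_type[OF fin \<Phi>_L]) (auto simp: T_def tp_def)
    show "tp a \<in> T" using ab T by simp
    fix y z assume yz: "y \<in> univ x0" "acc y z"
    then show "tp y \<in> T \<longleftrightarrow> tp z \<in> T"
      using T[OF yz(1)] T[OF acc_univ[OF yz]] acc_joined[OF yz] joined_sym
      by (meson rtrancl_trans)
  qed (use ab in auto)
  then have "(u, v) \<in> joined" using T ab by simp
  then obtain n where "(u, v) \<in> (R \<union> R\<inverse>) ^^ n" unfolding rtrancl_power by blast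
  then obtain f where f: "f 0 = u" "f n = v" "\<forall>i<n. (f i, f (Suc i)) \<in> R \<union> R\<inverse>"
    unfolding relpow_fun_conv by metis
  have "f i \<in> worlds" if "i \<le> n" for i
  proof (cases "i = n")
    case False
    then have "(f i, f (Suc i)) \<in> R \<union> R\<inverse>" using f(3) that by simp
    then show ?thesis using R_worlds by blast
  qed (use f uv in simp)
  then show "\<exists>n f. f 0 = u \<and> f n = v \<and> (\<forall>i\<le>n. f i \<in> worlds) \<and>
      (\<forall>i<n. (f i, f (Suc i)) \<in> R \<or> (f (Suc i), f i) \<in> R)"
    using f by (intro exI[of _ n] exI[of _ f]) auto
qed

end

section \<open>Transfer to worlds that are natural numbers\<close>

lemma sat_image:
  assumes f: "inj_on f W" and R: "R \<subseteq> W \<times> W" and h: "\<And>p. h p \<subseteq> W"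
  shows "w \<in> W \<Longrightarrow> sat (f ` W) (map_prod f f ` R) (\<lambda>p. f ` h p) (f w) \<phi> \<longleftrightarrow> sat W R h w \<phi>"
proof (induction \<phi> arbitrary: w)
  case (Atom p)
  then show ?case using f h[of p] by (auto dest: inj_onD)
next
  case (Box \<phi>)
  have eq: "(f w, v) \<in> map_prod f f ` R \<longleftrightarrow> (\<exists>u. v = f u \<and> (w, u) \<in> R)" for v
  proof
    assume "(f w, v) \<in> map_prod f f ` R"
    then obtain a b where ab: "(a, b) \<in> R" "f w = f a" "v = f b" by auto
    then have "w = a" using R Box.prems by (intro inj_onD[OF f]) auto
    then show "\<exists>u. v = f u \<and> (w, u) \<in> R" using ab by blast
  qed auto
  have "u \<in> W" if "(w, u) \<in> R" for u using that R by blast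
  then show ?case unfolding sat.simps eq using Box.IH by blast
next
  case (Tangle \<Gamma>)
  let ?R = "map_prod f f ` R"
  let ?sat = "\<lambda>v \<phi>. sat (f ` W) ?R (\<lambda>p. f ` h p) v \<phi>"
  have eq: "{n. ?sat (f (s n)) \<gamma>} = {n. sat W R h (s n) \<gamma>}"
    if "\<And>n. s n \<in> W" "\<gamma> \<in> fset \<Gamma>" for s \<gamma>
    using Tangle.IH that by blast
  show ?case
  proof
    assume "?sat (f w) (Tangle \<Gamma>)"
    then obtain s where s: "s 0 = f w" "\<And>n. (s n, s (Suc n)) \<in> ?R"
      "\<And>\<gamma>. \<gamma> \<in> fset \<Gamma> \<Longrightarrow> infinite {n. ?sat (s n) \<gamma>}" by auto
    have "\<exists>u. u \<in> W \<and> s n = f u" for n using s(2)[of n] R by auto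
    then obtain r where r: "\<And>n. r n \<in> W" "\<And>n. s n = f (r n)" by metis
    have "r 0 = w" using s(1) r f Tangle.prems by (metis inj_onD)
    moreover have "(r n, r (Suc n)) \<in> R" for n
    proof -
      obtain a b where ab: "(a, b) \<in> R" "f (r n) = f a" "f (r (Suc n)) = f b"
        using s(2)[of n] r(2) by auto
      have "r n = a" "r (Suc n) = b" using ab R r(1) by (auto intro!: inj_onD[OF f])
      then show ?thesis using ab by blast
    qed
    moreover have "infinite {n. sat W R h (r n) \<gamma>}" if "\<gamma> \<in> fset \<Gamma>" for \<gamma>
      using s(3)[OF that] eq[of r, OF r(1) that] r(2) by simp
    ultimately show "sat W R h w (Tangle \<Gamma>)" by auto
  next
    assume "sat W R h w (Tangle \<Gamma>)"
    then obtain s where s: "s 0 = w" "\<And>n. (s n, s (Suc n)) \<in> R"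
      "\<And>\<gamma>. \<gamma> \<in> fset \<Gamma> \<Longrightarrow> infinite {n. sat W R h (s n) \<gamma>}" by auto
    have "s n \<in> W" for n using s(2)[of n] R by auto
    then show "?sat (f w) (Tangle \<Gamma>)"
      using s eq[of s] by (auto intro!: exI[of _ "\<lambda>n. f (s n)"])
  qed
qed auto

lemma path_connected_image:
  assumes "path_connected_on W R"
  shows "path_connected_on (f ` W) (map_prod f f ` R)"
  unfolding path_connected_on_def
proof (intro ballI)
  fix x y assume "x \<in> f ` W" "y \<in> f ` W"
  then obtain a b where ab: "a \<in> W" "b \<in> W" "x = f a" "y = f b" by auto
  obtain n w where w: "w 0 = a" "w n = b" "\<forall>i\<le>n. w i \<in> W"
    "\<forall>i<n. (w i, w (Suc i)) \<in> R \<or> (w (Suc i), w i) \<in> R"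
    using assms[unfolded path_connected_on_def, rule_format, OF ab(1,2)] by metis
  have "(f (w i), f (w (Suc i))) \<in> map_prod f f ` R \<or> (f (w (Suc i)), f (w i)) \<in> map_prod f f ` R"
    if "i < n" for i
    using w(4) that by (force intro: map_prod_imageI)
  then show "\<exists>n w. w 0 = x \<and> w n = y \<and> (\<forall>i\<le>n. w i \<in> f ` W) \<and>
      (\<forall>i<n. (w i, w (Suc i)) \<in> map_prod f f ` R \<or> (w (Suc i), w i) \<in> map_prod f f ` R)"
    using w ab by (intro exI[of _ n] exI[of _ "\<lambda>i. f (w i)"]) auto
qed

lemma trans_image:
  assumes "inj_on f W" "R \<subseteq> W \<times> W" "trans R"
  shows "trans (map_prod f f ` R)"
proof (rule transI)
  fix x y z assume "(x, y) \<in> map_prod f f ` R" "(y, z) \<in> map_prod f f ` R"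
  then obtain a b b' c where "(a, b) \<in> R" "(b', c) \<in> R" "x = f a" "y = f b" "f b = f b'" "z = f c"
    by auto
  moreover from this have "b = b'" using assms(2) by (intro inj_onD[OF assms(1)]) auto
  ultimately show "(x, z) \<in> map_prod f f ` R" using assms(3) by (auto dest: transD intro: map_prod_imageI)
qed

section \<open>The finite model property\<close>

fun subformulas :: "'v fm \<Rightarrow> 'v fm set" where
  "subformulas (Atom p) = {Atom p}"
| "subformulas Top = {Top}"
| "subformulas (Neg \<phi>) = insert (Neg \<phi>) (subformulas \<phi>)"
| "subformulas (\<phi> \<^bold>\<and> \<psi>) = insert (\<phi> \<^bold>\<and> \<psi>) (subformulas \<phi> \<union> subformulas \<psi>)"
| "subformulas (Box \<phi>) = insert (Box \<phi>) (subformulas \<phi>)"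
| "subformulas (All \<phi>) = insert (All \<phi>) (subformulas \<phi>)"
| "subformulas (Tangle \<Gamma>) = insert (Tangle \<Gamma>) (\<Union>\<gamma>\<in>fset \<Gamma>. subformulas \<gamma>)"

lemma finite_subformulas: "finite (subformulas \<phi>)"
  by (induction \<phi>) auto

lemma subformulas_self: "\<phi> \<in> subformulas \<phi>"
  by (cases \<phi>) auto

lemma subformulas_trans: "\<psi> \<in> subformulas \<phi> \<Longrightarrow> subformulas \<psi> \<subseteq> subformulas \<phi>"
  by (induction \<phi>) auto

lemma (in tangle_logic) subformulas_L: "\<phi> \<in> L \<Longrightarrow> subformulas \<phi> \<subseteq> L"
  by (induction \<phi>) (auto dest: All_LD)

text \<open>Compare cardinalities first and break ties by an arbitrary enumeration.\<close>
lemma strict_inclusion_rank: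
  assumes "finite U"
  shows "\<exists>rk :: 'a set \<Rightarrow> nat. inj_on rk (Pow U) \<and> (\<forall>S S'. S' \<subseteq> U \<longrightarrow> S \<subset> S' \<longrightarrow> rk S < rk S')"
proof -
  obtain g :: "'a set \<Rightarrow> nat" and n where g: "g ` Pow U = {i. i < n}" "inj_on g (Pow U)"
    using finite_imp_inj_to_nat_seg[of "Pow U"] assms by auto
  have g_less: "g S < n" if "S \<subseteq> U" for S using g(1) that by auto
  define rk where "rk S = g S + card S * n" for S
  have "rk S < rk S'" if S: "S' \<subseteq> U" "S \<subset> S'" for S S'
  proof -
    have "card S < card S'" using S assms by (metis finite_subset psubset_card_mono)
    then have "Suc (card S) * n \<le> card S' * n" by (intro mult_le_mono1) simp
    moreover have "g S < n" using g_less S by blast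
    ultimately show ?thesis by (simp add: rk_def)
  qed
  moreover have "inj_on rk (Pow U)"
  proof (rule inj_onI)
    fix S S' assume S: "S \<in> Pow U" "S' \<in> Pow U" and eq: "rk S = rk S'"
    have "rk V mod n = g V" if "V \<in> Pow U" for V using g_less[of V] that by (simp add: rk_def)
    then have "g S = g S'" using S eq by metis
    then show "S = S'" using g(2) S by (simp add: inj_on_eq_iff)
  qed
  ultimately show ?thesis by blast
qed

lemma fmp_over_mono:
  "fmp_over L H K \<Longrightarrow> (\<And>W R. K W R \<Longrightarrow> K' W R) \<Longrightarrow> fmp_over L H K'"
  unfolding fmp_over_def by meson

context tangle_logic
begin

theorem finite_model_property:
  "fmp_over L (thms L A) (\<lambda>W R. trans R
    \<and> ((\<turnstile> Dia Top) \<longrightarrow> serial_on W R)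
    \<and> ((\<forall>\<psi>\<in>L. \<turnstile> \<psi> \<^bold>\<longrightarrow> Dia \<psi>) \<longrightarrow> refl_on W R)
    \<and> ((\<forall>\<chi>\<in>L. All \<chi> \<in> L \<and> (\<turnstile> All (BoxStar \<chi> \<^bold>\<or> BoxStar (Neg \<chi>)) \<^bold>\<longrightarrow> (All \<chi> \<^bold>\<or> All (Neg \<chi>))))
        \<longrightarrow> path_connected_on W R))"
  unfolding fmp_over_def
proof (intro ballI impI)
  fix \<phi> assume \<phi>: "\<phi> \<in> L" and cons: "consistent (thms L A) \<phi>"
  define \<Phi> where "\<Phi> = subformulas (Box (Neg Top) \<^bold>\<and> \<phi>)"
  have fin: "finite \<Phi>" unfolding \<Phi>_def by (rule finite_subformulas)
  have mem: "\<phi> \<in> \<Phi>" "Box (Neg Top) \<in> \<Phi>" using subformulas_self by (auto simp: \<Phi>_def)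
  have "con {\<phi>}"
  proof (rule ccontr)
    assume "\<not> con {\<phi>}"
    then obtain \<psi>s where "set \<psi>s \<subseteq> {}" "\<turnstile> foldr Imp \<psi>s (Neg \<phi>)"
      using inconsistent_insert[of \<phi> "{}"] \<phi> by auto
    then show False using cons by (simp add: consistent_def)
  qed
  then obtain x0 where max: "MCS x0" and start: "\<phi> \<in> x0" using lindenbaum[of "{\<phi>}"] \<phi> by auto
  obtain rk :: "'v fm set set \<Rightarrow> nat" where
    rk: "inj_on rk (Pow (Pow \<Phi>))" "\<And>S S'. S' \<subseteq> Pow \<Phi> \<Longrightarrow> S \<subset> S' \<Longrightarrow> rk S < rk S'"
    using strict_inclusion_rank[OF finite_Pow_iff[THEN iffD2, OF fin]] by metis
  have down: "\<psi> \<in> \<Phi>" if "\<chi> \<in> \<Phi>" "\<psi> \<in> subformulas \<chi>" for \<chi> \<psi>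
    using subformulas_trans that unfolding \<Phi>_def by blast
  interpret finite_model L A x0 \<Phi> rk "\<forall>\<psi>\<in>L. \<turnstile> \<psi> \<^bold>\<longrightarrow> Dia \<psi>"
  proof unfold_locales
    show "MCS x0" by (rule max)
    show "finite \<Phi>" by (rule fin)
    show "\<Phi> \<subseteq> L" unfolding \<Phi>_def using \<phi> by (intro subformulas_L) simp
    show "Box (Neg Top) \<in> \<Phi>" by (rule mem)
    show "\<psi> \<in> \<Phi>" if "Neg \<psi> \<in> \<Phi>" for \<psi>
      by (rule down[OF that]) (simp add: subformulas_self)
    show "\<psi> \<in> \<Phi> \<and> \<chi> \<in> \<Phi>" if "\<psi> \<^bold>\<and> \<chi> \<in> \<Phi>" for \<psi> \<chi>
      by (intro conjI down[OF that]) (simp_all add: subformulas_self)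
    show "\<psi> \<in> \<Phi>" if "Box \<psi> \<in> \<Phi>" for \<psi>
      by (rule down[OF that]) (simp add: subformulas_self)
    show "\<psi> \<in> \<Phi>" if "All \<psi> \<in> \<Phi>" for \<psi>
      by (rule down[OF that]) (simp add: subformulas_self)
    show "\<gamma> \<in> \<Phi>" if "Tangle \<Gamma> \<in> \<Phi>" "\<gamma> \<in> fset \<Gamma>" for \<Gamma> \<gamma>
      by (rule down[OF that(1)]) (use that(2) subformulas_self in auto)
  qed (use rk in blast)+
  obtain f :: "'v fm set \<times> 'v fm set set \<Rightarrow> nat" where f: "inj_on f worlds"
    using finite_imp_inj_to_nat_seg[OF finite_worlds] by metis
  let ?W = "f ` worlds" and ?R = "map_prod f f ` R" and ?h = "\<lambda>p. f ` val p"
  have w: "world x0 \<in> worlds" using x0 univ_self world_in by blast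
  have "\<phi> \<in> fst (world x0)" using start mem by (simp add: world_def tp_def)
  then have "sat worlds R val (world x0) \<phi>" using truth[OF w] mem by simp
  then have "sat ?W ?R ?h (f (world x0)) \<phi>" using sat_image[where h = val, OF f R_worlds val_worlds w] by simp
  then have "\<exists>w\<in>?W. sat ?W ?R ?h w \<phi>" using w by blast
  moreover have "frame ?W ?R" using w R_worlds by (auto simp: frame_def)
  moreover have "trans ?R" by (rule trans_image[OF f R_worlds trans_R])
  moreover have "(\<turnstile> Dia Top) \<longrightarrow> serial_on ?W ?R"
    using serial_R by (force simp: serial_on_def intro: map_prod_imageI)
  moreover have "(\<forall>\<psi>\<in>L. \<turnstile> \<psi> \<^bold>\<longrightarrow> Dia \<psi>) \<longrightarrow> refl_on ?W ?R"
  proof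
    assume "\<forall>\<psi>\<in>L. \<turnstile> \<psi> \<^bold>\<longrightarrow> Dia \<psi>"
    from refl_R[OF this] show "refl_on ?W ?R"
      using R_worlds by (force simp: refl_on_def intro: map_prod_imageI)
  qed
  moreover have "(\<forall>\<chi>\<in>L. All \<chi> \<in> L
      \<and> (\<turnstile> All (BoxStar \<chi> \<^bold>\<or> BoxStar (Neg \<chi>)) \<^bold>\<longrightarrow> (All \<chi> \<^bold>\<or> All (Neg \<chi>))))
    \<longrightarrow> path_connected_on ?W ?R"
    by (intro impI path_connected_image path_connected_R) blast+
  moreover have "finite ?W" using finite_worlds by simp
  moreover have "\<forall>p. ?h p \<subseteq> ?W" using val_worlds by blast
  ultimately show "\<exists>(W :: nat set) R h. finite W \<and> frame W R \<and> (trans R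
    \<and> ((\<turnstile> Dia Top) \<longrightarrow> serial_on W R)
    \<and> ((\<forall>\<psi>\<in>L. \<turnstile> \<psi> \<^bold>\<longrightarrow> Dia \<psi>) \<longrightarrow> refl_on W R)
    \<and> ((\<forall>\<chi>\<in>L. All \<chi> \<in> L \<and> (\<turnstile> All (BoxStar \<chi> \<^bold>\<or> BoxStar (Neg \<chi>)) \<^bold>\<longrightarrow> (All \<chi> \<^bold>\<or> All (Neg \<chi>))))
        \<longrightarrow> path_connected_on W R))
    \<and> (\<forall>p. h p \<subseteq> W) \<and> (\<exists>w\<in>W. sat W R h w \<phi>)"
    by (intro exI[of _ ?W] exI[of _ ?R] exI[of _ ?h] conjI)
qed

lemma fmp:
  "fmp_over L (thms L A) (\<lambda>W R. trans R
    \<and> (KD4t_axioms \<subseteq> A \<longrightarrow> serial_on W R)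
    \<and> (S4t_axioms \<subseteq> A \<longrightarrow> refl_on W R)
    \<and> (C_axioms \<subseteq> A \<and> L = L_BoxAll \<longrightarrow> path_connected_on W R))"
proof -
  have "\<turnstile> Dia Top" if "KD4t_axioms \<subseteq> A"
    using that by (intro thms.Ax) (auto simp: KD4t_axioms_def)
  moreover have "\<forall>\<psi>\<in>L. \<turnstile> \<psi> \<^bold>\<longrightarrow> Dia \<psi>" if "S4t_axioms \<subseteq> A"
    using that by (intro ballI thms.Ax) (auto simp: S4t_axioms_def)
  moreover have "All \<chi> \<in> L \<and> (\<turnstile> All (BoxStar \<chi> \<^bold>\<or> BoxStar (Neg \<chi>)) \<^bold>\<longrightarrow> (All \<chi> \<^bold>\<or> All (Neg \<chi>)))"
    if C: "C_axioms \<subseteq> A \<and> L = L_BoxAll" and \<chi>: "\<chi> \<in> L" for \<chi>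
  proof -
    have All: "All \<psi> \<in> L" if "\<psi> \<in> L" for \<psi> using C that by (auto intro: L_BoxAll.intros)
    have "All (BoxStar \<chi> \<^bold>\<or> BoxStar (Neg \<chi>)) \<^bold>\<longrightarrow> (All \<chi> \<^bold>\<or> All (Neg \<chi>)) \<in> A"
      using C by (auto simp: C_axioms_def)
    then show ?thesis using \<chi> by (intro conjI thms.Ax) (simp_all add: All)
  qed
  ultimately show ?thesis
    by (intro fmp_over_mono[OF finite_model_property]) auto
qed

end

lemma Neg_L_BoxAll: "Neg \<phi> \<in> L_BoxAll \<longleftrightarrow> \<phi> \<in> L_BoxAll"
  and And_L_BoxAll: "\<phi> \<^bold>\<and> \<psi> \<in> L_BoxAll \<longleftrightarrow> \<phi> \<in> L_BoxAll \<and> \<psi> \<in> L_BoxAll"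
  and Box_L_BoxAll: "Box \<phi> \<in> L_BoxAll \<longleftrightarrow> \<phi> \<in> L_BoxAll"
  and All_L_BoxAll: "All \<phi> \<in> L_BoxAll \<longleftrightarrow> \<phi> \<in> L_BoxAll"
  and Tangle_L_BoxAll:
    "Tangle \<Gamma> \<in> L_BoxAll \<longleftrightarrow> \<Gamma> \<noteq> {||} \<and> (\<forall>\<gamma>\<in>fset \<Gamma>. \<gamma> \<in> L_BoxAll)"
  by (auto intro: L_BoxAll.intros elim: L_BoxAll.cases)

lemmas L_BoxAll_simps =
  L_BoxAll.intros(2) Neg_L_BoxAll And_L_BoxAll Box_L_BoxAll All_L_BoxAll Tangle_L_BoxAll

lemma L_Box_logic:
  assumes "K4t_axioms \<subseteq> A"
  shows "tangle_logic L_Box A"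
proof
  have "\<phi> \<notin> L_Box" if "\<phi> \<in> U_axioms" for \<phi> :: "'v fm"
    using that by cases (auto simp: L_Box_def)
  then show "U_axioms \<inter> L_Box \<subseteq> A" by blast
qed (use assms in \<open>auto simp: L_Box_def L_BoxAll_simps\<close>)

lemma L_BoxAll_logic:
  assumes "K4t_axioms \<subseteq> A" "U_axioms \<subseteq> A"
  shows "tangle_logic L_BoxAll A"
  by unfold_locales (use assms in \<open>auto simp: L_BoxAll_simps\<close>)

theorem mainTheorem13:
  shows
    "(fmp_over L_Box (K4t :: 'v fm set) (\<lambda>W R. trans R)
      \<and> fmp_over L_Box (KD4t :: 'v fm set) (\<lambda>W R. serial_on W R \<and> trans R)
      \<and> fmp_over L_Box (S4t :: 'v fm set) (\<lambda>W R. refl_on W R \<and> trans R))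
   \<and> (fmp_over L_BoxAll (K4tU :: 'v fm set) (\<lambda>W R. trans R)
      \<and> fmp_over L_BoxAll (KD4tU :: 'v fm set) (\<lambda>W R. serial_on W R \<and> trans R)
      \<and> fmp_over L_BoxAll (S4tU :: 'v fm set) (\<lambda>W R. refl_on W R \<and> trans R))
   \<and> (fmp_over L_BoxAll (K4tUC :: 'v fm set) (\<lambda>W R. path_connected_on W R \<and> trans R)
      \<and> fmp_over L_BoxAll (KD4tUC :: 'v fm set) (\<lambda>W R. path_connected_on W R \<and> serial_on W R \<and> trans R)
      \<and> fmp_over L_BoxAll (S4tUC :: 'v fm set) (\<lambda>W R. path_connected_on W R \<and> refl_on W R \<and> trans R))"
proof -
  have K4: "K4t_axioms \<subseteq> KD4t_axioms" "K4t_axioms \<subseteq> S4t_axioms"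
    by (auto simp: KD4t_axioms_def S4t_axioms_def)
  note Box = tangle_logic.fmp[OF L_Box_logic, THEN fmp_over_mono]
    and BoxAll = tangle_logic.fmp[OF L_BoxAll_logic, THEN fmp_over_mono]
  show ?thesis
    unfolding K4t_def KD4t_def S4t_def K4tU_def KD4tU_def S4tU_def K4tUC_def KD4tUC_def S4tUC_def
    by (intro conjI; (rule Box BoxAll, (use K4 in blast)+))
qed

end
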